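(* Let $E$ be a semistable nef vector bundle of rank $r$ on a smooth complex projective variety $X$ of dimension $n$ with $c_2(\operatorname{End}(E)) = 0 \in H^4(X,\mathbb{Q})$. Then for every $k$ with $1\leq k \leq r$, the universal quotient bundle $Q_k$ on the Grassmann bundle $\operatorname{Gr}_X(k,E)$ is nef.
   Context: $\operatorname{Gr}_X(k,E)$ is the Grassmann bundle over $X$ parametrizing the $k$-dimensional quotients of the fibres of $E$, and $Q_k$ is its rank-$k$ universal quotient bundle. A vector bundle $V$ is nef if $\mathcal{O}_{\mathbb{P}(V)}(1)$ is nef on the projective bundle $\mathbb{P}(V)$ of one-dimensional quotients of $V$. "Semistable" means slope semistable with respect to an ample line bundle $H$ on $X$, with slope $\mu_H(\mathcal{G})=c_1(\mathcal{G})\cdot H^{\dim X-1}/\operatorname{rk}(\mathcal{G})$; for bundles with $c_2(\operatorname{End}(E))=0$ this does not depend on the choice of $H$, so $H$ is not mentioned. *)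

theory Defs
  imports "HOL-Homology.Homology" "Jordan_Normal_Form.Determinant"
begin

unbundle no vec_syntax

text \<open>
  Complex varieties are treated classically, as spaces with functions: a set of closed points
  with its Zariski topology and, for every open \<open>U\<close>, the set of regular functions
  \<open>U \<rightarrow> \<complex>\<close>.  Functions are total in HOL; the values of a regular function on \<open>U\<close> outside
  \<open>U\<close> carry no meaning.
\<close>

section \<open>Spaces with functions\<close>

record 'a fspace =
  zariski :: "'a topology"
  regular :: "'a set \<Rightarrow> ('a \<Rightarrow> complex) set"

abbreviation pts :: "'a fspace \<Rightarrow> 'a set" where
  "pts X \<equiv> topspace (zariski X)"

inductive_set rational_expr :: "'a set \<Rightarrow> ('a set \<times> ('a \<Rightarrow> complex)) set \<Rightarrow> ('a set \<times> ('a \<Rightarrow> complex)) set"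
  for S :: "'a set" and G :: "('a set \<times> ('a \<Rightarrow> complex)) set" where
  const: "(S, \<lambda>_. c) \<in> rational_expr S G"
| gen: "(D, f) \<in> G \<Longrightarrow> (S \<inter> D, f) \<in> rational_expr S G"
| add: "(D, f) \<in> rational_expr S G \<Longrightarrow> (D', g) \<in> rational_expr S G
    \<Longrightarrow> (D \<inter> D', \<lambda>x. f x + g x) \<in> rational_expr S G"
| mult: "(D, f) \<in> rational_expr S G \<Longrightarrow> (D', g) \<in> rational_expr S G
    \<Longrightarrow> (D \<inter> D', \<lambda>x. f x * g x) \<in> rational_expr S G"
| inv: "(D, f) \<in> rational_expr S G
    \<Longrightarrow> ({x \<in> D. f x \<noteq> 0}, \<lambda>x. inverse (f x)) \<in> rational_expr S G"

text \<open>
  The space with functions on \<open>S\<close> generated by partial functions \<open>(D, f) \<in> G\<close>: the coarsest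
  structure for which every \<open>D\<close> is open and every \<open>f\<close> is regular on \<open>D\<close>.  The domains of the
  rational expressions form a base of the topology (non-vanishing loci are open), and a function
  is regular if it is locally a rational expression.  For the coordinate functions on affine
  space this is the usual Zariski topology with its structure sheaf.
\<close>

definition generate :: "'a set \<Rightarrow> ('a set \<times> ('a \<Rightarrow> complex)) set \<Rightarrow> 'a fspace" where
  "generate S G = (let T = topology_generated_by (fst ` rational_expr S G) in
     \<lparr> zariski = T,
       regular = (\<lambda>U. {f. openin T U \<and>
         (\<forall>p\<in>U. \<exists>(D, g) \<in> rational_expr S G. p \<in> D \<and> D \<subseteq> U \<and> (\<forall>q\<in>D. f q = g q))}) \<rparr>)"

definition subspace_on :: "'a fspace \<Rightarrow> 'a set \<Rightarrow> 'a fspace" where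
  "subspace_on Y Z = generate Z {(U, f). openin (zariski Y) U \<and> f \<in> regular Y U}"

definition morphism :: "'a fspace \<Rightarrow> 'b fspace \<Rightarrow> ('a \<Rightarrow> 'b) \<Rightarrow> bool" where
  "morphism X Y \<phi> \<longleftrightarrow> continuous_map (zariski X) (zariski Y) \<phi> \<and>
     (\<forall>U f. openin (zariski Y) U \<and> f \<in> regular Y U \<longrightarrow>
        f \<circ> \<phi> \<in> regular X {x \<in> pts X. \<phi> x \<in> U})"

definition isomorphism :: "'a fspace \<Rightarrow> 'b fspace \<Rightarrow> ('a \<Rightarrow> 'b) \<Rightarrow> bool" where
  "isomorphism X Y \<phi> \<longleftrightarrow> homeomorphic_map (zariski X) (zariski Y) \<phi> \<and>
     (\<forall>U f. openin (zariski X) U \<longrightarrow>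
        (f \<in> regular X U \<longleftrightarrow> f \<circ> inv_into (pts X) \<phi> \<in> regular Y (\<phi> ` U)))"

definition closed_immersion :: "'a fspace \<Rightarrow> 'b fspace \<Rightarrow> ('a \<Rightarrow> 'b) \<Rightarrow> bool" where
  "closed_immersion X Y \<phi> \<longleftrightarrow> closedin (zariski Y) (\<phi> ` pts X) \<and>
     isomorphism X (subspace_on Y (\<phi> ` pts X)) \<phi>"

text \<open>Points of projective \<open>N\<close>-space are the lines through \<open>0\<close> in \<open>\<complex>\<^bsup>N+1\<^esup>\<close>.\<close>

definition line :: "complex Matrix.vec \<Rightarrow> complex Matrix.vec set" where
  "line v = range (\<lambda>c. c \<cdot>\<^sub>v v)"

definition projective_space :: "nat \<Rightarrow> complex Matrix.vec set fspace" where
  "projective_space N = generate {line v | v. v \<in> carrier_vec (Suc N) \<and> v \<noteq> 0\<^sub>v (Suc N)}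
     {({p. \<exists>v\<in>p. v $ j \<noteq> 0}, \<lambda>p. THE z. \<forall>v\<in>p. v $ i = z * v $ j) | i j. i \<le> N \<and> j \<le> N}"


section \<open>Smooth projective varieties\<close>

definition irreducible_closed :: "'a topology \<Rightarrow> 'a set \<Rightarrow> bool" where
  "irreducible_closed T Z \<longleftrightarrow> closedin T Z \<and> Z \<noteq> {} \<and>
     (\<forall>A B. closedin T A \<and> closedin T B \<and> Z \<subseteq> A \<union> B \<longrightarrow> Z \<subseteq> A \<or> Z \<subseteq> B)"

definition has_chain :: "'a topology \<Rightarrow> nat \<Rightarrow> bool" where
  "has_chain T m \<longleftrightarrow> (\<exists>Z. (\<forall>i\<le>m. irreducible_closed T (Z i)) \<and> (\<forall>i<m. Z i \<subset> Z (Suc i)))"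

definition krull_dim_is :: "'a topology \<Rightarrow> nat \<Rightarrow> bool" where
  "krull_dim_is T n \<longleftrightarrow> has_chain T n \<and> \<not> has_chain T (Suc n)"

definition codim_ge_2 :: "'a topology \<Rightarrow> 'a set \<Rightarrow> bool" where
  "codim_ge_2 T Z \<longleftrightarrow> (\<forall>W. irreducible_closed T W \<and> W \<subseteq> Z \<longrightarrow>
     (\<exists>W1 W2. irreducible_closed T W1 \<and> irreducible_closed T W2 \<and> W \<subset> W1 \<and> W1 \<subset> W2))"

text \<open>\<open>t 0, \<dots>, t (n-1)\<close> generate the maximal ideal of the local ring at \<open>p\<close>.\<close>

definition local_parameters :: "'a fspace \<Rightarrow> nat \<Rightarrow> 'a \<Rightarrow> 'a set \<Rightarrow> (nat \<Rightarrow> 'a \<Rightarrow> complex) \<Rightarrow> bool" where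
  "local_parameters X n p U t \<longleftrightarrow> openin (zariski X) U \<and> p \<in> U \<and>
     (\<forall>i<n. t i \<in> regular X U \<and> t i p = 0) \<and>
     (\<forall>V h. openin (zariski X) V \<and> p \<in> V \<and> h \<in> regular X V \<and> h p = 0 \<longrightarrow>
        (\<exists>W a. openin (zariski X) W \<and> p \<in> W \<and> W \<subseteq> U \<inter> V \<and>
           (\<forall>i<n. a i \<in> regular X W) \<and> (\<forall>q\<in>W. h q = (\<Sum>i<n. a i q * t i q))))"

text \<open>
  Smoothness is regularity of all local rings: the maximal ideal at every point is generated by
  \<open>n = dim X\<close> elements (the variety being irreducible, all local rings at closed points have
  dimension \<open>n\<close>).
\<close>

definition smooth_projective_variety :: "'a fspace \<Rightarrow> nat \<Rightarrow> bool" where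
  "smooth_projective_variety X n \<longleftrightarrow>
     (\<exists>N \<phi>. closed_immersion X (projective_space N) \<phi>) \<and>
     irreducible_closed (zariski X) (pts X) \<and>
     krull_dim_is (zariski X) n \<and>
     (\<forall>p\<in>pts X. \<exists>U t. local_parameters X n p U t)"


section \<open>Vector bundles\<close>

text \<open>
  A vector bundle is given by trivialisations over an open cover: \<open>transition E i j x\<close> converts
  coordinates in the frame \<open>j\<close> into coordinates in the frame \<open>i\<close>.
\<close>

record ('a, 'i) vbundle =
  vrank :: nat
  idx :: "'i set"
  chart :: "'i \<Rightarrow> 'a set"
  transition :: "'i \<Rightarrow> 'i \<Rightarrow> 'a \<Rightarrow> complex Matrix.mat"

definition vector_bundle :: "'a fspace \<Rightarrow> ('a, 'i) vbundle \<Rightarrow> bool" where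
  "vector_bundle X E \<longleftrightarrow>
     (\<forall>i\<in>idx E. openin (zariski X) (chart E i)) \<and> (\<Union>i\<in>idx E. chart E i) = pts X \<and>
     (\<forall>i\<in>idx E. \<forall>j\<in>idx E. \<forall>x\<in>chart E i \<inter> chart E j.
        transition E i j x \<in> carrier_mat (vrank E) (vrank E)) \<and>
     (\<forall>i\<in>idx E. \<forall>j\<in>idx E. \<forall>a<vrank E. \<forall>b<vrank E.
        (\<lambda>x. transition E i j x $$ (a, b)) \<in> regular X (chart E i \<inter> chart E j)) \<and>
     (\<forall>i\<in>idx E. \<forall>x\<in>chart E i. transition E i i x = 1\<^sub>m (vrank E)) \<and>
     (\<forall>i\<in>idx E. \<forall>j\<in>idx E. \<forall>k\<in>idx E. \<forall>x\<in>chart E i \<inter> chart E j \<inter> chart E k.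
        transition E i j x * transition E j k x = transition E i k x)"

definition line_bundle :: "'a fspace \<Rightarrow> ('a, 'i) vbundle \<Rightarrow> bool" where
  "line_bundle X L \<longleftrightarrow> vector_bundle X L \<and> vrank L = 1"

definition charts_at :: "('a, 'i) vbundle \<Rightarrow> 'a \<Rightarrow> 'i set" where
  "charts_at E x = {i \<in> idx E. x \<in> chart E i}"

text \<open>
  A vector of the fibre \<open>E\<^sub>x\<close> is the family of its coordinate vectors in all frames available at
  \<open>x\<close> (with the dummy value \<open>0\<close> in the other ones), so that the vector space operations of the
  fibre are the componentwise ones.
\<close>

definition fibre :: "('a, 'i) vbundle \<Rightarrow> 'a \<Rightarrow> ('i \<Rightarrow> complex Matrix.vec) set" where
  "fibre E x = {v. (\<forall>i. v i \<in> carrier_vec (vrank E)) \<and>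
     (\<forall>i. i \<notin> charts_at E x \<longrightarrow> v i = 0\<^sub>v (vrank E)) \<and>
     (\<forall>i\<in>charts_at E x. \<forall>j\<in>charts_at E x. v i = transition E i j x *\<^sub>v v j)}"

abbreviation fibre_zero :: "('a, 'i) vbundle \<Rightarrow> 'i \<Rightarrow> complex Matrix.vec" where
  "fibre_zero E \<equiv> (\<lambda>_. 0\<^sub>v (vrank E))"

definition sections :: "'a fspace \<Rightarrow> ('a, 'i) vbundle \<Rightarrow> 'a set \<Rightarrow> ('a \<Rightarrow> 'i \<Rightarrow> complex Matrix.vec) set" where
  "sections X E W = {s. openin (zariski X) W \<and> (\<forall>x\<in>W. s x \<in> fibre E x) \<and>
     (\<forall>i\<in>idx E. \<forall>a<vrank E. (\<lambda>x. s x i $ a) \<in> regular X (W \<inter> chart E i))}"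

definition total_space :: "'a fspace \<Rightarrow> ('a, 'i) vbundle \<Rightarrow> ('a \<times> ('i \<Rightarrow> complex Matrix.vec)) fspace" where
  "total_space X E = generate {(x, v). x \<in> pts X \<and> v \<in> fibre E x}
     ({(fst -` U, f \<circ> fst) | U f. openin (zariski X) U \<and> f \<in> regular X U} \<union>
      {(fst -` chart E i, \<lambda>(x, v). v i $ a) | i a. i \<in> idx E \<and> a < vrank E})"

definition pullback :: "'b fspace \<Rightarrow> ('b \<Rightarrow> 'a) \<Rightarrow> ('a, 'i) vbundle \<Rightarrow> ('b, 'i) vbundle" where
  "pullback Y \<phi> E = \<lparr> vrank = vrank E, idx = idx E,
     chart = (\<lambda>i. {y \<in> pts Y. \<phi> y \<in> chart E i}),
     transition = (\<lambda>i j y. transition E i j (\<phi> y)) \<rparr>"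

text \<open>
  In the frame \<open>i\<close> an endomorphism is a matrix \<open>A\<close>, stored as a vector with entry
  \<open>A\<^sub>a\<^sub>b\<close> at position \<open>a * r + b\<close>; the transition is \<open>A \<mapsto> g\<^sub>i\<^sub>j A g\<^sub>j\<^sub>i\<close> with \<open>g\<^sub>j\<^sub>i\<close> the
  inverse of \<open>g\<^sub>i\<^sub>j\<close>.
\<close>

definition End_bundle :: "('a, 'i) vbundle \<Rightarrow> ('a, 'i) vbundle" where
  "End_bundle E = (let r = vrank E in \<lparr> vrank = r * r, idx = idx E, chart = chart E,
     transition = (\<lambda>i j x. Matrix.mat (r * r) (r * r) (\<lambda>(p, q).
       transition E i j x $$ (p div r, q div r) * transition E j i x $$ (q mod r, p mod r))) \<rparr>)"

definition line_power :: "nat \<Rightarrow> ('a, 'i) vbundle \<Rightarrow> ('a, 'i) vbundle" where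
  "line_power m L = L \<lparr> transition := (\<lambda>i j x. Matrix.mat 1 1 (\<lambda>_. (transition L i j x $$ (0, 0)) ^ m)) \<rparr>"

text \<open>
  Very ample: finitely many global sections without common zero define a closed immersion
  \<open>x \<mapsto> [s\<^sub>0(x) : \<dots> : s\<^sub>N(x)]\<close>; the line does not depend on the frame in which the values are read.
\<close>

definition very_ample :: "'a fspace \<Rightarrow> ('a, 'i) vbundle \<Rightarrow> bool" where
  "very_ample X L \<longleftrightarrow> (\<exists>N s. (\<forall>a\<le>N. s a \<in> sections X L (pts X)) \<and>
     (\<forall>x\<in>pts X. \<exists>a\<le>N. s a x \<noteq> fibre_zero L) \<and>
     closed_immersion X (projective_space N)
       (\<lambda>x. line (Matrix.vec (Suc N) (\<lambda>a. s a x (SOME i. i \<in> charts_at L x) $ 0))))"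

definition ample :: "'a fspace \<Rightarrow> ('a, 'i) vbundle \<Rightarrow> bool" where
  "ample X L \<longleftrightarrow> line_bundle X L \<and> (\<exists>m\<ge>1. very_ample X (line_power m L))"


section \<open>Grassmann bundles\<close>

text \<open>
  A \<open>k\<close>-dimensional quotient of \<open>E\<^sub>x\<close> is recorded by its kernel, the kernel of a surjection
  \<open>M : E\<^sub>x \<rightarrow> \<complex>\<^sup>k\<close> written as a matrix in some frame.
\<close>

definition kernel_at :: "('a, 'i) vbundle \<Rightarrow> nat \<Rightarrow> 'a \<Rightarrow> 'i \<Rightarrow> complex Matrix.mat \<Rightarrow> ('i \<Rightarrow> complex Matrix.vec) set" where
  "kernel_at E k x i M = {v \<in> fibre E x. M *\<^sub>v v i = 0\<^sub>v k}"

definition quotient_kernels :: "nat \<Rightarrow> ('a, 'i) vbundle \<Rightarrow> 'a \<Rightarrow> ('i \<Rightarrow> complex Matrix.vec) set set" where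
  "quotient_kernels k E x = {kernel_at E k x i M | i M. i \<in> charts_at E x \<and> M \<in> carrier_mat k (vrank E) \<and>
     (\<lambda>v. M *\<^sub>v v) ` carrier_vec (vrank E) = carrier_vec k}"

text \<open>
  For a frame \<open>i\<close> and a list \<open>J\<close> of \<open>k\<close> indices, the standard chart \<open>(i, J)\<close> consists of the quotients
  for which the images of the basis vectors \<open>e\<^sub>J\<^sub>!\<^sub>0, \<dots>, e\<^sub>J\<^sub>!\<^sub>k\<^sub>-\<^sub>1\<close> of the frame form a basis; in this
  basis the quotient map has a unique matrix, whose columns at \<open>J\<close> are the unit vectors and
  whose other entries are the affine coordinates of the chart.
\<close>

definition normal_matrix :: "nat \<Rightarrow> ('a, 'i) vbundle \<Rightarrow> 'i \<times> nat list \<Rightarrow> 'a \<times> ('i \<Rightarrow> complex Matrix.vec) set \<Rightarrow> complex Matrix.mat \<Rightarrow> bool" where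
  "normal_matrix k E = (\<lambda>(i, J) (x, K) M. M \<in> carrier_mat k (vrank E) \<and> K = kernel_at E k x i M \<and>
     (\<forall>a<k. Matrix.col M (J ! a) = unit_vec k a))"

definition Gr_points :: "'a fspace \<Rightarrow> nat \<Rightarrow> ('a, 'i) vbundle \<Rightarrow> ('a \<times> ('i \<Rightarrow> complex Matrix.vec) set) set" where
  "Gr_points X k E = {(x, K). x \<in> pts X \<and> K \<in> quotient_kernels k E x}"

definition Gr_index :: "nat \<Rightarrow> ('a, 'i) vbundle \<Rightarrow> ('i \<times> nat list) set" where
  "Gr_index k E = {(i, J). i \<in> idx E \<and> length J = k \<and> set J \<subseteq> {..<vrank E}}"

definition Gr_chart :: "'a fspace \<Rightarrow> nat \<Rightarrow> ('a, 'i) vbundle \<Rightarrow> 'i \<times> nat list \<Rightarrow> ('a \<times> ('i \<Rightarrow> complex Matrix.vec) set) set" where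
  "Gr_chart X k E iJ = {p \<in> Gr_points X k E. fst iJ \<in> charts_at E (fst p) \<and> (\<exists>M. normal_matrix k E iJ p M)}"

definition Gr_matrix :: "nat \<Rightarrow> ('a, 'i) vbundle \<Rightarrow> 'i \<times> nat list \<Rightarrow> 'a \<times> ('i \<Rightarrow> complex Matrix.vec) set \<Rightarrow> complex Matrix.mat" where
  "Gr_matrix k E iJ p = (THE M. normal_matrix k E iJ p M)"

definition Gr :: "'a fspace \<Rightarrow> nat \<Rightarrow> ('a, 'i) vbundle \<Rightarrow> ('a \<times> ('i \<Rightarrow> complex Matrix.vec) set) fspace" where
  "Gr X k E = generate (Gr_points X k E)
     ({(fst -` U, f \<circ> fst) | U f. openin (zariski X) U \<and> f \<in> regular X U} \<union>
      {(Gr_chart X k E iJ, \<lambda>p. Gr_matrix k E iJ p $$ (a, b)) | iJ a b.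
         iJ \<in> Gr_index k E \<and> a < k \<and> b < vrank E})"

text \<open>
  The fibre of the universal quotient at \<open>(x, K)\<close> is \<open>E\<^sub>x / K\<close>, with the frame given over the chart
  \<open>(i, J)\<close> by the classes of the \<open>e\<^sub>J\<^sub>!\<^sub>b\<close>.  The transition matrix from \<open>(j, J')\<close> to \<open>(i, J)\<close> has as its
  \<open>b\<close>-th column the class of the \<open>J'!b\<close>-th basis vector of the frame \<open>j\<close>.
\<close>

definition universal_quotient :: "'a fspace \<Rightarrow> nat \<Rightarrow> ('a, 'i) vbundle
    \<Rightarrow> ('a \<times> ('i \<Rightarrow> complex Matrix.vec) set, 'i \<times> nat list) vbundle" where
  "universal_quotient X k E = \<lparr> vrank = k, idx = Gr_index k E, chart = Gr_chart X k E,
     transition = (\<lambda>iJ jJ' p. Matrix.mat k k (\<lambda>(a, b).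
       (Gr_matrix k E iJ p * transition E (fst iJ) (fst jJ') (fst p)) $$ (a, snd jJ' ! b))) \<rparr>"

text \<open>\<open>\<P>(V)\<close> parametrises one-dimensional quotients, and \<open>\<O>(1)\<close> is the universal one.\<close>

abbreviation Proj :: "'a fspace \<Rightarrow> ('a, 'i) vbundle \<Rightarrow> ('a \<times> ('i \<Rightarrow> complex Matrix.vec) set) fspace" where
  "Proj X V \<equiv> Gr X 1 V"

abbreviation O1 :: "'a fspace \<Rightarrow> ('a, 'i) vbundle
    \<Rightarrow> ('a \<times> ('i \<Rightarrow> complex Matrix.vec) set, 'i \<times> nat list) vbundle" where
  "O1 X V \<equiv> universal_quotient X 1 V"


section \<open>Rational singular cohomology of the analytic topology\<close>

definition analytic :: "'a fspace \<Rightarrow> 'a topology" where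
  "analytic X = topology_generated_by
     {{x \<in> U. f x \<in> B} | U f B. openin (zariski X) U \<and> f \<in> regular X U \<and> open B}"

type_synonym 'a cochain = "((nat \<Rightarrow> real) \<Rightarrow> 'a) \<Rightarrow> rat"

definition evaluate :: "'a cochain \<Rightarrow> 'a chain \<Rightarrow> rat" where
  "evaluate \<alpha> c = (\<Sum>\<sigma>\<in>Poly_Mapping.keys c. of_int (Poly_Mapping.lookup c \<sigma>) * \<alpha> \<sigma>)"

text \<open>Only the values of a \<open>p\<close>-cochain on singular \<open>p\<close>-simplices of the space matter.\<close>

definition cocycle :: "nat \<Rightarrow> 'a topology \<Rightarrow> 'a cochain \<Rightarrow> bool" where
  "cocycle p T \<alpha> \<longleftrightarrow> (\<forall>\<sigma>. singular_simplex (Suc p) T \<sigma> \<longrightarrow>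
     evaluate \<alpha> (chain_boundary (Suc p) (frag_of \<sigma>)) = 0)"

definition cohomologous :: "nat \<Rightarrow> 'a topology \<Rightarrow> 'a cochain \<Rightarrow> 'a cochain \<Rightarrow> bool" where
  "cohomologous p T \<alpha> \<beta> \<longleftrightarrow> (\<exists>\<gamma>. \<forall>\<sigma>. singular_simplex p T \<sigma> \<longrightarrow>
     \<alpha> \<sigma> - \<beta> \<sigma> = evaluate \<gamma> (chain_boundary p (frag_of \<sigma>)))"

text \<open>Cohomology classes are represented as sets of cocycles; this is the zero class.\<close>

definition zero_cohomology_class :: "nat \<Rightarrow> 'a topology \<Rightarrow> 'a cochain set" where
  "zero_cohomology_class p T = {\<alpha>. cocycle p T \<alpha> \<and> cohomologous p T \<alpha> (\<lambda>_. 0)}"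

definition cochain_pullback :: "nat \<Rightarrow> ('a \<Rightarrow> 'b) \<Rightarrow> 'b cochain \<Rightarrow> 'a cochain" where
  "cochain_pullback p \<phi> \<alpha> = (\<lambda>\<sigma>. \<alpha> (simplex_map p \<phi> \<sigma>))"

text \<open>
  The cup product evaluates on the front \<open>p\<close>-face and the back \<open>q\<close>-face of a \<open>(p+q)\<close>-simplex.
  As points of the standard simplices are finitely supported sequences, the front face
  inclusion is the set inclusion.
\<close>

definition cup :: "nat \<Rightarrow> nat \<Rightarrow> 'a cochain \<Rightarrow> 'a cochain \<Rightarrow> 'a cochain" where
  "cup p q \<alpha> \<beta> = (\<lambda>\<sigma>. \<alpha> (restrict \<sigma> (standard_simplex p)) *
     \<beta> (restrict (\<lambda>x. \<sigma> (\<lambda>i. if i < p then 0 else x (i - p))) (standard_simplex q)))"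

primrec cup_power2 :: "'a cochain \<Rightarrow> nat \<Rightarrow> 'a cochain" where
  "cup_power2 h 0 = (\<lambda>_. 1)"
| "cup_power2 h (Suc m) = cup 2 (2 * m) h (cup_power2 h m)"

text \<open>
  The positively oriented affine simplex in \<open>\<real>\<^sup>m\<close> with vertices \<open>-(e\<^sub>1 + \<dots> + e\<^sub>m), e\<^sub>1, \<dots>, e\<^sub>m\<close>, which
  contains \<open>0\<close> in its interior.
\<close>

definition orientation_simplex :: "nat \<Rightarrow> (nat \<Rightarrow> real) \<Rightarrow> nat \<Rightarrow> real" where
  "orientation_simplex m = oriented_simplex m
     (\<lambda>j i. if j = 0 then (if i < m then -1 else 0) else (if i = j - 1 then 1 else 0))"

definition realify :: "nat \<Rightarrow> (nat \<Rightarrow> 'a \<Rightarrow> complex) \<Rightarrow> 'a \<Rightarrow> nat \<Rightarrow> real" where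
  "realify n t q = (\<lambda>m. if m < 2 * n then (if even m then Re (t (m div 2) q) else Im (t (m div 2) q)) else 0)"

text \<open>
  A cycle representing the fundamental class of the compact complex manifold \<open>X\<close> of dimension \<open>n\<close>:
  at every point \<open>p\<close> it restricts in \<open>H\<^sub>2\<^sub>n(X, X - p)\<close> to the class which local parameters
  (local holomorphic coordinates) carry to the standard generator of \<open>H\<^sub>2\<^sub>n(\<complex>\<^sup>n, \<complex>\<^sup>n - 0)\<close>.
\<close>

definition fundamental_cycle :: "'a fspace \<Rightarrow> nat \<Rightarrow> 'a chain \<Rightarrow> bool" where
  "fundamental_cycle X n z \<longleftrightarrow>
     singular_relcycle (2 * n) (analytic X) {} z \<and>
     (\<forall>p U t. local_parameters X n p U t \<longrightarrow>
       (\<exists>W c. openin (analytic X) W \<and> p \<in> W \<and> W \<subseteq> U \<and>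
          (\<forall>q\<in>W - {p}. \<exists>i<n. t i q \<noteq> 0) \<and>
          singular_chain (2 * n) (subtopology (analytic X) W) c \<and>
          homologous_rel (2 * n) (analytic X) (topspace (analytic X) - {p}) z c \<and>
          homologous_rel (2 * n) (Euclidean_space (2 * n)) (topspace (Euclidean_space (2 * n)) - {\<lambda>_. 0})
            (chain_map (2 * n) (realify n t) c) (frag_of (orientation_simplex (2 * n)))))"

definition integral_over :: "'a fspace \<Rightarrow> nat \<Rightarrow> 'a cochain \<Rightarrow> rat" where
  "integral_over X n \<alpha> = evaluate \<alpha> (SOME z. fundamental_cycle X n z)"


section \<open>Chern classes\<close>

text \<open>
  The triangle with vertices \<open>v, \<omega>v, \<omega>\<^sup>2v\<close>, \<open>\<omega> = e\<^bsup>2\<pi>i/3\<^esup>\<close>, around the origin of the complex line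
  \<open>L\<^sub>x\<close>: for \<open>v \<noteq> 0\<close> it represents the orientation generator of \<open>H\<^sub>2(L\<^sub>x, L\<^sub>x - 0)\<close>.
\<close>

definition fibre_triangle :: "'a \<Rightarrow> ('i \<Rightarrow> complex Matrix.vec) \<Rightarrow> (nat \<Rightarrow> real) \<Rightarrow> 'a \<times> ('i \<Rightarrow> complex Matrix.vec)" where
  "fibre_triangle x v = restrict (\<lambda>t. (x, \<lambda>i.
     (of_real (t 0) + of_real (t 1) * cis (2 * pi / 3) + of_real (t 2) * cis (4 * pi / 3)) \<cdot>\<^sub>v v i))
     (standard_simplex 2)"

definition thom_cocycle :: "'a fspace \<Rightarrow> ('a, 'i) vbundle \<Rightarrow> ('a \<times> ('i \<Rightarrow> complex Matrix.vec)) cochain \<Rightarrow> bool" where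
  "thom_cocycle X L u \<longleftrightarrow> (let T = analytic (total_space X L) in
     cocycle 2 T u \<and>
     (\<forall>\<sigma>. singular_simplex 2 (subtopology T {(x, v). v \<noteq> fibre_zero L}) \<sigma> \<longrightarrow> u \<sigma> = 0) \<and>
     (\<forall>x\<in>pts X. \<forall>v\<in>fibre L x. v \<noteq> fibre_zero L \<longrightarrow> u (fibre_triangle x v) = 1))"

text \<open>
  First Chern class of a line bundle as the Euler class of the underlying oriented real plane
  bundle: the restriction of the Thom class to the zero section.
\<close>

definition c1_line :: "'a fspace \<Rightarrow> ('a, 'i) vbundle \<Rightarrow> 'a cochain set" where
  "c1_line X L = {z. cocycle 2 (analytic X) z \<and> (\<exists>u. thom_cocycle X L u \<and>
     cohomologous 2 (analytic X) z (cochain_pullback 2 (\<lambda>x. (x, fibre_zero L)) u))}"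

text \<open>
  Grothendieck's definition: \<open>\<Sum>\<^sub>i (-1)\<^sup>i \<pi>\<^sup>*c\<^sub>i(E) \<xi>\<^bsup>r-i\<^esup> = 0\<close> in the cohomology of \<open>\<pi> : \<P>(E) \<rightarrow> X\<close>, where
  \<open>\<xi> = c\<^sub>1(\<O>(1))\<close>, \<open>c\<^sub>0(E) = 1\<close> and \<open>c\<^sub>i(E) = 0\<close> for \<open>i > r\<close>.  The signs are those for the projective
  bundle of one-dimensional quotients.
\<close>

definition chern_cocycles :: "'a fspace \<Rightarrow> ('a, 'i) vbundle \<Rightarrow> (nat \<Rightarrow> 'a cochain) \<Rightarrow> bool" where
  "chern_cocycles X E c \<longleftrightarrow> (let r = vrank E in
     (\<forall>i. cocycle (2 * i) (analytic X) (c i)) \<and>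
     cohomologous 0 (analytic X) (c 0) (\<lambda>_. 1) \<and>
     (\<forall>i>r. cohomologous (2 * i) (analytic X) (c i) (\<lambda>_. 0)) \<and>
     (\<exists>\<xi>\<in>c1_line (Proj X E) (O1 X E).
        cohomologous (2 * r) (analytic (Proj X E))
          (\<lambda>\<sigma>. \<Sum>i\<le>r. (-1) ^ i * cup (2 * i) (2 * (r - i))
             (cochain_pullback (2 * i) fst (c i)) (cup_power2 \<xi> (r - i)) \<sigma>)
          (\<lambda>_. 0)))"

definition chern_class :: "'a fspace \<Rightarrow> ('a, 'i) vbundle \<Rightarrow> nat \<Rightarrow> 'a cochain set" where
  "chern_class X E i = {\<alpha>. \<exists>c. chern_cocycles X E c \<and> \<alpha> = c i}"


section \<open>Nefness\<close>

definition curve_degree :: "'a fspace \<Rightarrow> ('a, 'i) vbundle \<Rightarrow> rat" where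
  "curve_degree C L = integral_over C 1 (SOME a. a \<in> c1_line C L)"

text \<open>
  A line bundle is nef if it has non-negative degree on every curve, i.e. its pull-back along
  every morphism from a smooth projective curve (such as the normalisation of a curve lying in
  \<open>Y\<close>) has non-negative degree.  The type of \<open>C\<close> is that of points of projective spaces, so \<open>C\<close>
  runs over all smooth projective curves up to isomorphism.
\<close>

definition nef_line_bundle :: "'a fspace \<Rightarrow> ('a, 'i) vbundle \<Rightarrow> bool" where
  "nef_line_bundle Y L \<longleftrightarrow> (\<forall>(C :: complex Matrix.vec set fspace) \<nu>.
     smooth_projective_variety C 1 \<and> morphism C Y \<nu> \<longrightarrow> curve_degree C (pullback C \<nu> L) \<ge> 0)"

definition nef :: "'a fspace \<Rightarrow> ('a, 'i) vbundle \<Rightarrow> bool" where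
  "nef X V \<longleftrightarrow> nef_line_bundle (Proj X V) (O1 X V)"


section \<open>Slope semistability\<close>

definition lincomb :: "('a, 'i) vbundle \<Rightarrow> nat \<Rightarrow> (nat \<Rightarrow> 'a \<Rightarrow> complex) \<Rightarrow> (nat \<Rightarrow> 'a \<Rightarrow> 'i \<Rightarrow> complex Matrix.vec)
    \<Rightarrow> 'a \<Rightarrow> 'i \<Rightarrow> complex Matrix.vec" where
  "lincomb E m c s = (\<lambda>x i. Matrix.vec (vrank E) (\<lambda>a. \<Sum>b<m. c b x * s b x i $ a))"

text \<open>
  Coherent subsheaves of the sheaf of sections of \<open>E\<close>; for a subsheaf of a locally free sheaf
  (over a Noetherian space) coherence amounts to being locally finitely generated.
\<close>

definition coherent_subsheaf :: "'a fspace \<Rightarrow> ('a, 'i) vbundle \<Rightarrow> ('a set \<Rightarrow> ('a \<Rightarrow> 'i \<Rightarrow> complex Matrix.vec) set) \<Rightarrow> bool" where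
  "coherent_subsheaf X E F \<longleftrightarrow>
     (\<forall>W. F W \<subseteq> sections X E W) \<and>
     (\<forall>W s s'. s \<in> F W \<and> (\<forall>x\<in>W. s' x = s x) \<longrightarrow> s' \<in> F W) \<and>
     (\<forall>W m c s. openin (zariski X) W \<and> (\<forall>b<m. c b \<in> regular X W \<and> s b \<in> F W) \<longrightarrow> lincomb E m c s \<in> F W) \<and>
     (\<forall>W V s. openin (zariski X) V \<and> V \<subseteq> W \<and> s \<in> F W \<longrightarrow> s \<in> F V) \<and>
     (\<forall>W s. openin (zariski X) W \<and>
        (\<forall>p\<in>W. \<exists>V. openin (zariski X) V \<and> p \<in> V \<and> V \<subseteq> W \<and> s \<in> F V) \<longrightarrow> s \<in> F W) \<and>
     (\<forall>p\<in>pts X. \<exists>V m s. openin (zariski X) V \<and> p \<in> V \<and> (\<forall>b<m. s b \<in> F V) \<and>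
        (\<forall>W t. openin (zariski X) W \<and> W \<subseteq> V \<and> t \<in> F W \<longrightarrow>
          (\<forall>q\<in>W. \<exists>W' c. openin (zariski X) W' \<and> q \<in> W' \<and> W' \<subseteq> W \<and> (\<forall>b<m. c b \<in> regular X W') \<and>
             (\<forall>x\<in>W'. t x = lincomb E m c s x))))"

text \<open>\<open>f 0, \<dots>, f (s-1)\<close> is a basis of the module sheaf \<open>F\<close> over \<open>W\<close>.\<close>

definition sheaf_frame :: "'a fspace \<Rightarrow> ('a, 'i) vbundle \<Rightarrow> ('a set \<Rightarrow> ('a \<Rightarrow> 'i \<Rightarrow> complex Matrix.vec) set)
    \<Rightarrow> nat \<Rightarrow> 'a set \<Rightarrow> (nat \<Rightarrow> 'a \<Rightarrow> 'i \<Rightarrow> complex Matrix.vec) \<Rightarrow> bool" where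
  "sheaf_frame X E F s W f \<longleftrightarrow> openin (zariski X) W \<and> (\<forall>b<s. f b \<in> F W) \<and>
     (\<forall>W' t. openin (zariski X) W' \<and> W' \<subseteq> W \<and> t \<in> F W' \<longrightarrow>
        (\<exists>c. (\<forall>b<s. c b \<in> regular X W') \<and> (\<forall>x\<in>W'. t x = lincomb E s c f x))) \<and>
     (\<forall>W' c. openin (zariski X) W' \<and> W' \<subseteq> W \<and> (\<forall>b<s. c b \<in> regular X W') \<and>
        (\<forall>x\<in>W'. lincomb E s c f x = fibre_zero E) \<longrightarrow> (\<forall>b<s. \<forall>x\<in>W'. c b x = 0))"

text \<open>
  \<open>L\<close> is the determinant of the torsion-free sheaf \<open>F\<close> of rank \<open>s\<close>: \<open>F\<close> is locally free of rank \<open>s\<close>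
  on an open \<open>U\<close> whose complement has codimension at least 2, and \<open>\<Lambda>\<^sup>sF \<cong> L\<close> over \<open>U\<close>.  The
  isomorphism is given by the images \<open>\<lambda> W f\<close> of \<open>f 0 \<and> \<dots> \<and> f (s-1)\<close> for the local frames \<open>f\<close> of \<open>F\<close>.  On a
  smooth variety this determines \<open>L\<close> up to isomorphism as the bidual of \<open>\<Lambda>\<^sup>sF\<close>, and \<open>c\<^sub>1(F) = c\<^sub>1(L)\<close>.
\<close>

definition is_determinant :: "'a fspace \<Rightarrow> ('a, 'i) vbundle \<Rightarrow> ('a set \<Rightarrow> ('a \<Rightarrow> 'i \<Rightarrow> complex Matrix.vec) set)
    \<Rightarrow> nat \<Rightarrow> ('a, 'j) vbundle \<Rightarrow> bool" where
  "is_determinant X E F s L \<longleftrightarrow> line_bundle X L \<and>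
     (\<exists>U. openin (zariski X) U \<and> codim_ge_2 (zariski X) (pts X - U) \<and>
       (\<forall>p\<in>U. \<exists>W f. p \<in> W \<and> W \<subseteq> U \<and> sheaf_frame X E F s W f) \<and>
       (\<exists>\<Lambda>.
         (\<forall>W f. W \<subseteq> U \<and> sheaf_frame X E F s W f \<longrightarrow>
            \<Lambda> W f \<in> sections X L W \<and> (\<forall>x\<in>W. \<Lambda> W f x \<noteq> fibre_zero L)) \<and>
         (\<forall>W f W' f' V A. W \<subseteq> U \<and> sheaf_frame X E F s W f \<and> W' \<subseteq> U \<and> sheaf_frame X E F s W' f' \<and>
            openin (zariski X) V \<and> V \<subseteq> W \<inter> W' \<and>
            (\<forall>x\<in>V. A x \<in> carrier_mat s s) \<and>
            (\<forall>a<s. \<forall>b<s. (\<lambda>x. A x $$ (a, b)) \<in> regular X V) \<and>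
            (\<forall>b<s. \<forall>x\<in>V. f' b x = lincomb E s (\<lambda>a x. A x $$ (a, b)) f x) \<longrightarrow>
            (\<forall>x\<in>V. \<forall>i. \<Lambda> W' f' x i = Determinant.det (A x) \<cdot>\<^sub>v \<Lambda> W f x i))))"

text \<open>
  As \<open>X\<close> is quasi-compact, every line bundle is up to isomorphism given by a finite cover, so \<open>\<nat>\<close> is
  a sufficient index type for determinants.
\<close>

definition sheaf_rank :: "'a fspace \<Rightarrow> ('a, 'i) vbundle \<Rightarrow> ('a set \<Rightarrow> ('a \<Rightarrow> 'i \<Rightarrow> complex Matrix.vec) set) \<Rightarrow> nat" where
  "sheaf_rank X E F = (THE s. \<exists>L :: ('a, nat) vbundle. is_determinant X E F s L)"

definition sheaf_det :: "'a fspace \<Rightarrow> ('a, 'i) vbundle \<Rightarrow> ('a set \<Rightarrow> ('a \<Rightarrow> 'i \<Rightarrow> complex Matrix.vec) set)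
    \<Rightarrow> ('a, nat) vbundle" where
  "sheaf_det X E F = (SOME L. is_determinant X E F (sheaf_rank X E F) L)"

text \<open>\<open>c\<^sub>1(L) \<cdot> H\<^bsup>n-1\<^esup>\<close>; in dimension 0, where \<open>H\<^bsup>n-1\<^esup>\<close> has no meaning, all degrees are taken to be 0.\<close>

definition H_degree :: "'a fspace \<Rightarrow> nat \<Rightarrow> ('a, 'j) vbundle \<Rightarrow> ('a, 'i) vbundle \<Rightarrow> rat" where
  "H_degree X n H L = (if n = 0 then 0 else
     integral_over X n (cup 2 (2 * (n - 1)) (SOME a. a \<in> c1_line X L)
       (cup_power2 (SOME h. h \<in> c1_line X H) (n - 1))))"

definition slope :: "'a fspace \<Rightarrow> nat \<Rightarrow> ('a, 'j) vbundle \<Rightarrow> ('a, 'i) vbundle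
    \<Rightarrow> ('a set \<Rightarrow> ('a \<Rightarrow> 'i \<Rightarrow> complex Matrix.vec) set) \<Rightarrow> rat" where
  "slope X n H E F = H_degree X n H (sheaf_det X E F) / of_nat (sheaf_rank X E F)"

definition semistable :: "'a fspace \<Rightarrow> nat \<Rightarrow> ('a, 'j) vbundle \<Rightarrow> ('a, 'i) vbundle \<Rightarrow> bool" where
  "semistable X n H E \<longleftrightarrow> (\<forall>F. coherent_subsheaf X E F \<and>
     0 < sheaf_rank X E F \<and> sheaf_rank X E F < vrank E \<longrightarrow>
     slope X n H E F \<le> slope X n H E (sections X E))"

end

theory Submission
  imports Defs
begin

text \<open>
  The universal quotient \<open>Q\<close> is a quotient of the pull-back of \<open>E\<close> to the Grassmann bundle, and quotients
  of nef bundles are nef.  A point of \<open>\<P>(Q)\<close> is a point \<open>x\<close> of \<open>X\<close>, a quotient \<open>E\<^sub>x / K\<close> and a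
  one-dimensional quotient of \<open>E\<^sub>x / K\<close>; composing the two quotient maps gives a one-dimensional quotient
  of \<open>E\<^sub>x\<close>.  This is a morphism \<open>\<P>(Q) \<rightarrow> \<P>(E)\<close> (\<open>composite_quotient_morphism\<close>) along which \<open>\<O>(1)\<close> pulls back to
  \<open>\<O>(1)\<close>.  Hence the degree of \<open>\<O>(1)\<close> on a curve \<open>C \<rightarrow> \<P>(Q)\<close> is its degree on the composite curve
  \<open>C \<rightarrow> \<P>(E)\<close>, which is non-negative because \<open>E\<close> is nef.

  The line bundles compared here are given by different covers.  The frame of \<open>\<O>(1)\<close> on \<open>\<P>(Q)\<close> over a
  standard chart is the class of a basis vector of a frame of \<open>E\<close>, and so is a frame of \<open>\<O>(1)\<close> on \<open>\<P>(E)\<close>: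
  the former cover refines the pull-back of the latter, with the same transition functions
  (\<open>composite_transition\<close>).  A refinement induces a fibrewise linear homeomorphism of total spaces,
  along which Thom cocycles can be transported in both directions; therefore the cocycles
  representing the first Chern class are the same ones (\<open>c1_line_refinement\<close>), and so is the degree.

  That the projective and Grassmann bundles behave as they should rests on one fact of linear
  algebra (\<open>factor_through_section\<close>): a linear map that vanishes on the kernel of \<open>N\<close> absorbs the projector
  \<open>S N\<close>, for every section \<open>S\<close> of \<open>N\<close>.  It gives the uniqueness of normal matrices, the cocycle condition
  of the universal quotient and the well-definedness of the projection \<open>E\<^sub>x \<rightarrow> E\<^sub>x / K\<close>.
\<close>

section \<open>Regular functions on generated spaces\<close>

lemma rational_expr_domain: "(D, f) \<in> rational_expr S G \<Longrightarrow> D \<subseteq> S"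
  by (induction rule: rational_expr.induct) auto

text \<open>
  The domains of rational expressions are closed under finite intersections, as the sum of two
  expressions is defined on the intersection of their domains; so they form a base.
\<close>

lemma openin_generate:
  "openin (zariski (generate S G)) U \<longleftrightarrow>
    (\<forall>p\<in>U. \<exists>D g. (D, g) \<in> rational_expr S G \<and> p \<in> D \<and> D \<subseteq> U)"
proof
  assume "openin (zariski (generate S G)) U"
  then have "generate_topology_on (fst ` rational_expr S G) U"
    by (simp add: generate_def Let_def openin_topology_generated_by)
  then show "\<forall>p\<in>U. \<exists>D g. (D, g) \<in> rational_expr S G \<and> p \<in> D \<and> D \<subseteq> U"
  proof (induction rule: generate_topology_on.induct)
    case (Int a b)
    show ?case
    proof
      fix p assume "p \<in> a \<inter> b"
      then obtain D g D' g' where "(D, g) \<in> rational_expr S G" "p \<in> D" "D \<subseteq> a"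
        "(D', g') \<in> rational_expr S G" "p \<in> D'" "D' \<subseteq> b"
        using Int.IH by (meson IntD1 IntD2)
      then show "\<exists>D g. (D, g) \<in> rational_expr S G \<and> p \<in> D \<and> D \<subseteq> a \<inter> b"
        using rational_expr.add[of D g S G D' g'] by (intro exI[of _ "D \<inter> D'"]) blast
    qed
  next
    case (UN K)
    then show ?case by (meson Union_iff Union_upper subset_trans)
  next
    case (Basis s)
    then show ?case by force
  qed auto
next
  assume *: "\<forall>p\<in>U. \<exists>D g. (D, g) \<in> rational_expr S G \<and> p \<in> D \<and> D \<subseteq> U"
  have "openin (zariski (generate S G)) D" if "(D, g) \<in> rational_expr S G" for D g
    using that by (auto simp: generate_def Let_def intro!: topology_generated_by_Basis image_eqI)
  with * show "openin (zariski (generate S G)) U"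
    by (subst openin_subopen) blast
qed

lemma pts_generate [simp]: "pts (generate S G) = S"
proof
  show "pts (generate S G) \<subseteq> S"
    using openin_generate[of S G "pts (generate S G)"] rational_expr_domain by fastforce
  show "S \<subseteq> pts (generate S G)"
    using openin_generate[of S G S] rational_expr.const[of S _ G] openin_subset by blast
qed

lemma regular_generate:
  "f \<in> regular (generate S G) U \<longleftrightarrow>
    (\<forall>p\<in>U. \<exists>D g. (D, g) \<in> rational_expr S G \<and> p \<in> D \<and> D \<subseteq> U \<and> (\<forall>q\<in>D. f q = g q))"
  (is "_ \<longleftrightarrow> ?R")
proof -
  have "f \<in> regular (generate S G) U \<longleftrightarrow> openin (zariski (generate S G)) U \<and> ?R"
    unfolding generate_def Let_def fspace.simps mem_Collect_eq Bex_def split_paired_Ex by simp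
  moreover have "?R \<Longrightarrow> openin (zariski (generate S G)) U"
    unfolding openin_generate by blast
  ultimately show ?thesis by blast
qed

lemma regular_openin: "f \<in> regular (generate S G) U \<Longrightarrow> openin (zariski (generate S G)) U"
  unfolding regular_generate openin_generate by meson

lemma regular_rational_expr: "(D, f) \<in> rational_expr S G \<Longrightarrow> f \<in> regular (generate S G) D"
  unfolding regular_generate by blast

lemma regular_generator: "(D, f) \<in> G \<Longrightarrow> f \<in> regular (generate S G) (S \<inter> D)"
  by (intro regular_rational_expr rational_expr.gen)

lemma regular_local:
  assumes "\<And>p. p \<in> U \<Longrightarrow> \<exists>V g. p \<in> V \<and> V \<subseteq> U \<and> g \<in> regular (generate S G) V \<and> (\<forall>q\<in>V. f q = g q)"
  shows "f \<in> regular (generate S G) U"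
  unfolding regular_generate
proof
  fix p assume p: "p \<in> U"
  from assms[OF p] obtain V g where V: "p \<in> V" "V \<subseteq> U" "g \<in> regular (generate S G) V"
      "\<forall>q\<in>V. f q = g q"
    by blast
  from V(1,3) obtain D h where "(D, h) \<in> rational_expr S G" "p \<in> D" "D \<subseteq> V" "\<forall>q\<in>D. g q = h q"
    unfolding regular_generate by meson
  with V show "\<exists>D h. (D, h) \<in> rational_expr S G \<and> p \<in> D \<and> D \<subseteq> U \<and> (\<forall>q\<in>D. f q = h q)"
    by (intro exI[of _ D] exI[of _ h]) auto
qed

lemma regular_cong:
  "g \<in> regular (generate S G) U \<Longrightarrow> (\<And>q. q \<in> U \<Longrightarrow> f q = g q) \<Longrightarrow> f \<in> regular (generate S G) U"
  by (rule regular_local) blast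

lemma regular_restrict:
  assumes "f \<in> regular (generate S G) U" "openin (zariski (generate S G)) V" "V \<subseteq> U"
  shows "f \<in> regular (generate S G) V"
  unfolding regular_generate
proof
  fix p assume p: "p \<in> V"
  obtain D g where D: "(D, g) \<in> rational_expr S G" "p \<in> D" "\<forall>q\<in>D. f q = g q"
    using assms p unfolding regular_generate by blast
  obtain D' g' where D': "(D', g') \<in> rational_expr S G" "p \<in> D'" "D' \<subseteq> V"
    using assms p unfolding openin_generate by blast
  \<comment> \<open>Adding \<open>0\<close> times an expression on \<open>D'\<close> shrinks the domain to \<open>D' \<inter> D\<close> and keeps the values.\<close>
  have "(D' \<inter> D, \<lambda>x. (0 * g' x) + g x) \<in> rational_expr S G"
    using rational_expr.add[OF rational_expr.mult[OF rational_expr.const[of S 0] D'(1)] D(1)]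
      rational_expr_domain[OF D'(1)] by (simp add: Int_absorb1)
  then show "\<exists>D g. (D, g) \<in> rational_expr S G \<and> p \<in> D \<and> D \<subseteq> V \<and> (\<forall>q\<in>D. f q = g q)"
    using D D' by (intro exI[of _ "D' \<inter> D"] exI conjI) auto
qed

lemma regular_const:
  assumes "openin (zariski (generate S G)) U"
  shows "(\<lambda>_. c) \<in> regular (generate S G) U"
  using regular_restrict[OF regular_rational_expr[OF rational_expr.const] assms]
    openin_subset[OF assms] by simp

lemma regular_binary:
  assumes f: "f \<in> regular (generate S G) U" and g: "g \<in> regular (generate S G) U"
    and op: "\<And>D D' f' g'. (D, f') \<in> rational_expr S G \<Longrightarrow> (D', g') \<in> rational_expr S G
      \<Longrightarrow> (D \<inter> D', \<lambda>x. op (f' x) (g' x)) \<in> rational_expr S G"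
  shows "(\<lambda>x. op (f x) (g x)) \<in> regular (generate S G) U"
  unfolding regular_generate
proof
  fix p assume p: "p \<in> U"
  obtain D f' where D: "(D, f') \<in> rational_expr S G" "p \<in> D" "D \<subseteq> U" "\<forall>q\<in>D. f q = f' q"
    using f p unfolding regular_generate by blast
  obtain D' g' where D': "(D', g') \<in> rational_expr S G" "p \<in> D'" "D' \<subseteq> U" "\<forall>q\<in>D'. g q = g' q"
    using g p unfolding regular_generate by blast
  show "\<exists>D h. (D, h) \<in> rational_expr S G \<and> p \<in> D \<and> D \<subseteq> U \<and> (\<forall>q\<in>D. op (f q) (g q) = h q)"
    using op[OF D(1) D'(1)] D D' by (intro exI[of _ "D \<inter> D'"] exI conjI) auto
qed

lemma regular_add:
  assumes "f \<in> regular (generate S G) U" "g \<in> regular (generate S G) U"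
  shows "(\<lambda>x. f x + g x) \<in> regular (generate S G) U"
  by (rule regular_binary[OF assms]) (rule rational_expr.add)

lemma regular_mult:
  assumes "f \<in> regular (generate S G) U" "g \<in> regular (generate S G) U"
  shows "(\<lambda>x. f x * g x) \<in> regular (generate S G) U"
  by (rule regular_binary[OF assms]) (rule rational_expr.mult)

lemma regular_sum:
  assumes "openin (zariski (generate S G)) U" "\<And>c. c \<in> I \<Longrightarrow> f c \<in> regular (generate S G) U"
  shows "(\<lambda>x. \<Sum>c\<in>I. f c x) \<in> regular (generate S G) U"
  using assms(2)
proof (induction I rule: infinite_finite_induct)
  case (insert c I)
  then have "(\<lambda>x. f c x + (\<Sum>c\<in>I. f c x)) \<in> regular (generate S G) U"
    by (intro regular_add) auto
  with insert.hyps show ?case by simp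
qed (simp_all add: regular_const[OF assms(1)])

lemma regular_inverse:
  assumes "f \<in> regular (generate S G) U"
  shows "(\<lambda>x. inverse (f x)) \<in> regular (generate S G) {x \<in> U. f x \<noteq> 0}"
  unfolding regular_generate
proof
  fix p assume p: "p \<in> {x \<in> U. f x \<noteq> 0}"
  then obtain D f' where D: "(D, f') \<in> rational_expr S G" "p \<in> D" "D \<subseteq> U" "\<forall>q\<in>D. f q = f' q"
    using assms unfolding regular_generate by blast
  show "\<exists>D g. (D, g) \<in> rational_expr S G \<and> p \<in> D \<and> D \<subseteq> {x \<in> U. f x \<noteq> 0} \<and>
      (\<forall>q\<in>D. inverse (f q) = g q)"
    using rational_expr.inv[OF D(1)] D p
    by (intro exI[of _ "{x \<in> D. f' x \<noteq> 0}"] exI[of _ "\<lambda>x. inverse (f' x)"] conjI) auto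
qed

text \<open>
  Every rational expression in the generators is pulled back to the same expression in the
  pulled back generators, so it suffices to test a morphism on the generators.
\<close>

lemma morphism_generate:
  assumes maps: "\<And>x. x \<in> S \<Longrightarrow> \<phi> x \<in> S'"
    and gens: "\<And>D f. (D, f) \<in> G' \<Longrightarrow> f \<circ> \<phi> \<in> regular (generate S G) {x \<in> S. \<phi> x \<in> D}"
  shows "morphism (generate S G) (generate S' G') \<phi>"
proof -
  have expr: "f \<circ> \<phi> \<in> regular (generate S G) {x \<in> S. \<phi> x \<in> D}"
    if "(D, f) \<in> rational_expr S' G'" for D f
    using that
  proof (induction rule: rational_expr.induct)
    case (const c)
    have "{x \<in> S. \<phi> x \<in> S'} = S" using maps by auto
    then show ?case using regular_rational_expr[OF rational_expr.const] by (simp add: o_def)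
  next
    case (gen D f)
    have "{x \<in> S. \<phi> x \<in> S' \<inter> D} = {x \<in> S. \<phi> x \<in> D}" using maps by auto
    then show ?case using gens[OF gen] by (simp add: o_def)
  next
    case (add D f D' g)
    have eq: "{x \<in> S. \<phi> x \<in> D \<inter> D'} = {x \<in> S. \<phi> x \<in> D} \<inter> {x \<in> S. \<phi> x \<in> D'}" by auto
    have U: "openin (zariski (generate S G)) {x \<in> S. \<phi> x \<in> D \<inter> D'}"
      unfolding eq using add.IH by (intro openin_Int regular_openin)
    have "f \<circ> \<phi> \<in> regular (generate S G) {x \<in> S. \<phi> x \<in> D \<inter> D'}"
      by (rule regular_restrict[OF add.IH(1) U]) auto
    moreover have "g \<circ> \<phi> \<in> regular (generate S G) {x \<in> S. \<phi> x \<in> D \<inter> D'}"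
      by (rule regular_restrict[OF add.IH(2) U]) auto
    ultimately have "(\<lambda>x. (f \<circ> \<phi>) x + (g \<circ> \<phi>) x) \<in> regular (generate S G) {x \<in> S. \<phi> x \<in> D \<inter> D'}"
      by (rule regular_add)
    then show ?case by (simp add: o_def)
  next
    case (mult D f D' g)
    have eq: "{x \<in> S. \<phi> x \<in> D \<inter> D'} = {x \<in> S. \<phi> x \<in> D} \<inter> {x \<in> S. \<phi> x \<in> D'}" by auto
    have U: "openin (zariski (generate S G)) {x \<in> S. \<phi> x \<in> D \<inter> D'}"
      unfolding eq using mult.IH by (intro openin_Int regular_openin)
    have "f \<circ> \<phi> \<in> regular (generate S G) {x \<in> S. \<phi> x \<in> D \<inter> D'}"
      by (rule regular_restrict[OF mult.IH(1) U]) auto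
    moreover have "g \<circ> \<phi> \<in> regular (generate S G) {x \<in> S. \<phi> x \<in> D \<inter> D'}"
      by (rule regular_restrict[OF mult.IH(2) U]) auto
    ultimately have "(\<lambda>x. (f \<circ> \<phi>) x * (g \<circ> \<phi>) x) \<in> regular (generate S G) {x \<in> S. \<phi> x \<in> D \<inter> D'}"
      by (rule regular_mult)
    then show ?case by (simp add: o_def)
  next
    case (inv D f)
    have "{x \<in> S. \<phi> x \<in> {y \<in> D. f y \<noteq> 0}} = {x \<in> {x \<in> S. \<phi> x \<in> D}. (f \<circ> \<phi>) x \<noteq> 0}" by auto
    then show ?case using regular_inverse[OF inv.IH] by (simp add: o_def)
  qed
  have "openin (zariski (generate S G)) {x \<in> S. \<phi> x \<in> U}"
    if U: "openin (zariski (generate S' G')) U" for U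
  proof (subst openin_subopen, intro ballI)
    fix x assume x: "x \<in> {x \<in> S. \<phi> x \<in> U}"
    then obtain D f where "(D, f) \<in> rational_expr S' G'" "\<phi> x \<in> D" "D \<subseteq> U"
      using U unfolding openin_generate by blast
    then show "\<exists>T. openin (zariski (generate S G)) T \<and> x \<in> T \<and> T \<subseteq> {x \<in> S. \<phi> x \<in> U}"
      using x regular_openin[OF expr] by blast
  qed
  moreover have "f \<circ> \<phi> \<in> regular (generate S G) {x \<in> S. \<phi> x \<in> U}"
    if f: "f \<in> regular (generate S' G') U" for U f
  proof (rule regular_local)
    fix x assume x: "x \<in> {x \<in> S. \<phi> x \<in> U}"
    then obtain D g where "(D, g) \<in> rational_expr S' G'" "\<phi> x \<in> D" "D \<subseteq> U" "\<forall>q\<in>D. f q = g q"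
      using f unfolding regular_generate by blast
    then show "\<exists>V g. x \<in> V \<and> V \<subseteq> {x \<in> S. \<phi> x \<in> U} \<and> g \<in> regular (generate S G) V \<and>
        (\<forall>q\<in>V. (f \<circ> \<phi>) q = g q)"
      using x expr by (intro exI[of _ "{x \<in> S. \<phi> x \<in> D}"] exI[of _ "g \<circ> \<phi>"]) auto
  qed
  ultimately show ?thesis
    unfolding morphism_def continuous_map using maps by auto
qed

lemma morphism_compose:
  assumes "morphism X Y \<phi>" "morphism Y Z \<psi>"
  shows "morphism X Z (\<psi> \<circ> \<phi>)"
proof -
  have cont: "continuous_map (zariski X) (zariski Y) \<phi>" "continuous_map (zariski Y) (zariski Z) \<psi>"
    using assms by (auto simp: morphism_def)
  have "f \<circ> (\<psi> \<circ> \<phi>) \<in> regular X {x \<in> pts X. (\<psi> \<circ> \<phi>) x \<in> U}"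
    if U: "openin (zariski Z) U" "f \<in> regular Z U" for U f
  proof -
    let ?V = "{y \<in> pts Y. \<psi> y \<in> U}"
    have "openin (zariski Y) ?V" using cont(2) U(1) by (simp add: continuous_map)
    moreover have "f \<circ> \<psi> \<in> regular Y ?V" using assms(2) U by (simp add: morphism_def)
    ultimately have "(f \<circ> \<psi>) \<circ> \<phi> \<in> regular X {x \<in> pts X. \<phi> x \<in> ?V}"
      using assms(1) unfolding morphism_def by blast
    moreover have "{x \<in> pts X. \<phi> x \<in> ?V} = {x \<in> pts X. (\<psi> \<circ> \<phi>) x \<in> U}"
      using cont(1) by (auto simp: continuous_map_def)
    ultimately show ?thesis by (simp add: o_assoc)
  qed
  with cont show ?thesis by (auto simp: morphism_def intro: continuous_map_compose)
qed

section \<open>The analytic topology\<close>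

lemma topspace_analytic_generate [simp]: "topspace (analytic (generate S G)) = S"
proof
  show "topspace (analytic (generate S G)) \<subseteq> S"
    using openin_subset[of "zariski (generate S G)"] by (fastforce simp: analytic_def)
  have S: "openin (zariski (generate S G)) S"
    using openin_topspace[of "zariski (generate S G)"] by simp
  have "openin (analytic (generate S G)) {x \<in> S. (0::complex) \<in> UNIV}"
    unfolding analytic_def using S regular_const[OF S, of 0] open_UNIV
    by (intro topology_generated_by_Basis) blast
  then show "S \<subseteq> topspace (analytic (generate S G))"
    by (auto dest: openin_subset)
qed

lemma morphism_continuous_analytic:
  assumes "morphism (generate S G) (generate S' G') \<phi>"
  shows "continuous_map (analytic (generate S G)) (analytic (generate S' G')) \<phi>"
proof -
  let ?T = "analytic (generate S G)"
  have cont: "continuous_map (zariski (generate S G)) (zariski (generate S' G')) \<phi>"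
    using assms by (simp add: morphism_def)
  have "openin ?T (\<phi> -` {x \<in> U. f x \<in> B} \<inter> topspace ?T)"
    if "openin (zariski (generate S' G')) U" "f \<in> regular (generate S' G') U" "open B" for U f B
  proof -
    have "openin (zariski (generate S G)) {x \<in> S. \<phi> x \<in> U}"
      using cont that(1) by (auto simp: continuous_map)
    moreover have "f \<circ> \<phi> \<in> regular (generate S G) {x \<in> S. \<phi> x \<in> U}"
      using assms that by (auto simp: morphism_def)
    ultimately have "openin ?T {x \<in> {x \<in> S. \<phi> x \<in> U}. (f \<circ> \<phi>) x \<in> B}"
      unfolding analytic_def using that(3) by (intro topology_generated_by_Basis) blast
    moreover have "{x \<in> {x \<in> S. \<phi> x \<in> U}. (f \<circ> \<phi>) x \<in> B} = \<phi> -` {x \<in> U. f x \<in> B} \<inter> topspace ?T"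
      by auto
    ultimately show ?thesis by simp
  qed
  moreover have "\<phi> ` topspace ?T \<subseteq> topspace (analytic (generate S' G'))"
    using cont by (auto simp: continuous_map_def)
  ultimately show ?thesis
    unfolding analytic_def[of "generate S' G'"]
    by (intro continuous_on_generated_topo) auto
qed

section \<open>Euler classes of isomorphic line bundles\<close>

lemma topspace_analytic_subset: "topspace (analytic X) \<subseteq> pts X"
  by (auto simp: analytic_def dest: openin_subset)

lemma evaluate_eq_superset:
  assumes "finite K" "Poly_Mapping.keys c \<subseteq> K"
  shows "evaluate \<alpha> c = (\<Sum>\<sigma>\<in>K. of_int (Poly_Mapping.lookup c \<sigma>) * \<alpha> \<sigma>)"
  unfolding evaluate_def using assms
  by (intro sum.mono_neutral_left) (auto simp: Poly_Mapping.in_keys_iff)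

lemma evaluate_diff: "evaluate \<alpha> (c - d) = evaluate \<alpha> c - evaluate \<alpha> d"
proof -
  let ?K = "Poly_Mapping.keys c \<union> Poly_Mapping.keys d"
  have K: "finite ?K" by simp
  have "evaluate \<alpha> (c - d) = (\<Sum>\<sigma>\<in>?K. of_int (Poly_Mapping.lookup (c - d) \<sigma>) * \<alpha> \<sigma>)"
    using evaluate_eq_superset[OF K keys_diff] .
  also have "\<dots> = (\<Sum>\<sigma>\<in>?K. of_int (Poly_Mapping.lookup c \<sigma>) * \<alpha> \<sigma>)
      - (\<Sum>\<sigma>\<in>?K. of_int (Poly_Mapping.lookup d \<sigma>) * \<alpha> \<sigma>)"
    by (simp add: lookup_minus left_diff_distrib sum_subtractf)
  finally show ?thesis
    using evaluate_eq_superset[OF K, of c \<alpha>] evaluate_eq_superset[OF K, of d \<alpha>] by simp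
qed

lemma evaluate_pullback:
  "evaluate (cochain_pullback p \<phi> \<alpha>) c = evaluate \<alpha> (chain_map p \<phi> c)"
proof (induction c rule: frag_induction[OF subset_UNIV])
  case 1
  then show ?case by (simp add: evaluate_def)
next
  case (2 \<sigma>)
  then show ?case by (simp add: evaluate_def cochain_pullback_def)
next
  case (3 a b)
  then show ?case by (simp add: evaluate_diff chain_map_diff)
qed

lemma cocycle_pullback:
  assumes "cocycle p T' \<alpha>" and "continuous_map T T' \<phi>"
  shows "cocycle p T (cochain_pullback p \<phi> \<alpha>)"
  unfolding cocycle_def
proof (intro allI impI)
  fix \<sigma> assume \<sigma>: "singular_simplex (Suc p) T \<sigma>"
  have "chain_map p \<phi> (chain_boundary (Suc p) (frag_of \<sigma>))
      = chain_boundary (Suc p) (frag_of (simplex_map (Suc p) \<phi> \<sigma>))"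
    using chain_boundary_chain_map[of "Suc p" T "frag_of \<sigma>" \<phi>] \<sigma>
    by (simp add: singular_chain_of)
  with assms \<sigma> show "evaluate (cochain_pullback p \<phi> \<alpha>) (chain_boundary (Suc p) (frag_of \<sigma>)) = 0"
    by (simp add: evaluate_pullback cocycle_def singular_simplex_simplex_map)
qed

lemma topspace_analytic_total_space [simp]:
  "topspace (analytic (total_space X E)) = {(x, v). x \<in> pts X \<and> v \<in> fibre E x}"
  by (simp add: total_space_def)

lemma fibre_carrier: "v \<in> fibre E x \<Longrightarrow> v i \<in> carrier_vec (vrank E)"
  by (simp add: fibre_def)

text \<open>
  A Thom cocycle of \<open>N\<close> pulls back to a Thom cocycle of \<open>M\<close> along a map of the total spaces that
  is linear and injective on the fibres; as the map respects the zero sections, both cocycles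
  have the same restriction to the base.
\<close>

lemma c1_line_mono:
  assumes morph: "morphism (total_space X M) (total_space X N) (\<lambda>(x, v). (x, \<psi> x v))"
    and lin: "\<And>x v c. x \<in> pts X \<Longrightarrow> v \<in> fibre M x \<Longrightarrow> \<psi> x (\<lambda>i. c \<cdot>\<^sub>v v i) = (\<lambda>i. c \<cdot>\<^sub>v \<psi> x v i)"
    and inj: "\<And>x v. x \<in> pts X \<Longrightarrow> v \<in> fibre M x \<Longrightarrow> \<psi> x v = fibre_zero N \<Longrightarrow> v = fibre_zero M"
    and zero: "\<And>x. x \<in> pts X \<Longrightarrow> \<psi> x (fibre_zero M) = fibre_zero N"
  shows "c1_line X N \<subseteq> c1_line X M"
proof
  let ?\<psi> = "\<lambda>(x, v). (x, \<psi> x v)"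
  let ?TM = "analytic (total_space X M)" and ?TN = "analytic (total_space X N)"
  have cont: "continuous_map ?TM ?TN ?\<psi>"
    using morph unfolding total_space_def by (rule morphism_continuous_analytic)
  have maps: "\<psi> x v \<in> fibre N x" if "x \<in> pts X" "v \<in> fibre M x" for x v
    using cont that by (auto simp: continuous_map_def Pi_iff)
  fix z assume "z \<in> c1_line X N"
  then obtain u where z: "cocycle 2 (analytic X) z" and u: "thom_cocycle X N u"
    and zu: "cohomologous 2 (analytic X) z (cochain_pullback 2 (\<lambda>x. (x, fibre_zero N)) u)"
    unfolding c1_line_def by blast
  let ?u = "cochain_pullback 2 ?\<psi> u"
  have "thom_cocycle X M ?u"
    unfolding thom_cocycle_def Let_def
  proof (intro conjI allI ballI impI)
    show "cocycle 2 ?TM ?u"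
      using u cont cocycle_pullback unfolding thom_cocycle_def Let_def by blast
  next
    fix \<sigma> assume \<sigma>: "singular_simplex 2 (subtopology ?TM {(x, v). v \<noteq> fibre_zero M}) \<sigma>"
    have "continuous_map (subtopology ?TM {(x, v). v \<noteq> fibre_zero M})
        (subtopology ?TN {(x, v). v \<noteq> fibre_zero N}) ?\<psi>"
      using cont inj
      by (intro continuous_map_into_subtopology continuous_map_from_subtopology) auto
    from singular_simplex_simplex_map[OF \<sigma> this] show "?u \<sigma> = 0"
      using u by (simp add: thom_cocycle_def Let_def cochain_pullback_def)
  next
    fix x v assume xv: "x \<in> pts X" "v \<in> fibre M x" "v \<noteq> fibre_zero M"
    have "simplex_map 2 ?\<psi> (fibre_triangle x v) = fibre_triangle x (\<psi> x v)"
      using lin[OF xv(1,2)] by (auto simp: simplex_map_def fibre_triangle_def restrict_def)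
    moreover have "\<psi> x v \<noteq> fibre_zero N" using inj xv by blast
    ultimately show "?u (fibre_triangle x v) = 1"
      using u maps xv by (simp add: thom_cocycle_def Let_def cochain_pullback_def)
  qed
  moreover have "cochain_pullback 2 (\<lambda>x. (x, fibre_zero M)) ?u \<sigma> = cochain_pullback 2 (\<lambda>x. (x, fibre_zero N)) u \<sigma>"
    if \<sigma>: "singular_simplex 2 (analytic X) \<sigma>" for \<sigma>
  proof -
    have "simplex_map 2 ?\<psi> (simplex_map 2 (\<lambda>x. (x, fibre_zero M)) \<sigma>)
        = simplex_map 2 (?\<psi> \<circ> (\<lambda>x. (x, fibre_zero M))) \<sigma>"
      by (simp add: simplex_map_compose)
    also have "\<dots> = simplex_map 2 (\<lambda>x. (x, fibre_zero N)) \<sigma>"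
      using zero topspace_analytic_subset[of X] by (intro simplex_map_eq[OF \<sigma>]) auto
    finally show ?thesis by (simp add: cochain_pullback_def)
  qed
  ultimately show "z \<in> c1_line X M"
    using z zu unfolding c1_line_def cohomologous_def by force
qed

section \<open>Refinements of the trivialising cover\<close>

lemma mult_mat_vec_zero: "A \<in> carrier_mat m n \<Longrightarrow> A *\<^sub>v 0\<^sub>v n = 0\<^sub>v m"
  by (intro eq_vecI) auto

lemma vector_bundleD:
  assumes "vector_bundle X E"
  shows chart_open: "i \<in> idx E \<Longrightarrow> openin (zariski X) (chart E i)"
    and charts_cover: "(\<Union>i\<in>idx E. chart E i) = pts X"
    and transition_carrier: "i \<in> charts_at E x \<Longrightarrow> j \<in> charts_at E x
      \<Longrightarrow> transition E i j x \<in> carrier_mat (vrank E) (vrank E)"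
    and transition_regular: "i \<in> idx E \<Longrightarrow> j \<in> idx E \<Longrightarrow> a < vrank E \<Longrightarrow> b < vrank E
      \<Longrightarrow> (\<lambda>x. transition E i j x $$ (a, b)) \<in> regular X (chart E i \<inter> chart E j)"
    and transition_self: "i \<in> charts_at E x \<Longrightarrow> transition E i i x = 1\<^sub>m (vrank E)"
    and transition_cocycle: "i \<in> charts_at E x \<Longrightarrow> j \<in> charts_at E x \<Longrightarrow> l \<in> charts_at E x
      \<Longrightarrow> transition E i j x * transition E j l x = transition E i l x"
  using assms by (auto simp: vector_bundle_def charts_at_def)

lemma charts_at_pts: "vector_bundle X E \<Longrightarrow> i \<in> charts_at E x \<Longrightarrow> x \<in> pts X"
  unfolding charts_at_def using charts_cover by blast

lemma charts_at_nonempty: "vector_bundle X E \<Longrightarrow> x \<in> pts X \<Longrightarrow> charts_at E x \<noteq> {}"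
  unfolding charts_at_def using charts_cover by blast

lemma fibre_change_frame:
  "v \<in> fibre E x \<Longrightarrow> i \<in> charts_at E x \<Longrightarrow> j \<in> charts_at E x \<Longrightarrow> v i = transition E i j x *\<^sub>v v j"
  unfolding fibre_def by blast

lemma fibre_outside: "v \<in> fibre E x \<Longrightarrow> i \<notin> charts_at E x \<Longrightarrow> v i = 0\<^sub>v (vrank E)"
  by (simp add: fibre_def)

lemma fibre_vector_exists:
  assumes E: "vector_bundle X E" and i: "i \<in> charts_at E x" and u: "u \<in> carrier_vec (vrank E)"
  obtains v where "v \<in> fibre E x" "v i = u"
proof -
  let ?v = "\<lambda>j. if j \<in> charts_at E x then transition E j i x *\<^sub>v u else 0\<^sub>v (vrank E)"
  note c = transition_carrier[OF E]
  have "?v \<in> fibre E x"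
    unfolding fibre_def using mult_mat_vec_carrier[OF c u] i
    by (auto simp: transition_cocycle[OF E] simp flip: assoc_mult_mat_vec[OF c c u])
  moreover have "?v i = u" using i u by (simp add: transition_self[OF E])
  ultimately show ?thesis by (rule that)
qed

lemma total_space_regular_base:
  assumes "openin (zariski X) U" "f \<in> regular X U"
  shows "(\<lambda>p. f (fst p)) \<in> regular (total_space X E) {(x, v). x \<in> U \<and> v \<in> fibre E x}"
proof -
  have "{(x, v). x \<in> pts X \<and> v \<in> fibre E x} \<inter> fst -` U = {(x, v). x \<in> U \<and> v \<in> fibre E x}"
    using openin_subset[OF assms(1)] by auto
  moreover have "f \<circ> fst \<in> regular (total_space X E) ({(x, v). x \<in> pts X \<and> v \<in> fibre E x} \<inter> fst -` U)"
    unfolding total_space_def by (rule regular_generator) (use assms in blast)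
  ultimately show ?thesis by (simp add: o_def)
qed

lemma total_space_regular_coordinate:
  assumes "vector_bundle X E" "i \<in> idx E" "a < vrank E"
  shows "(\<lambda>p. snd p i $ a) \<in> regular (total_space X E) {(x, v). x \<in> chart E i \<and> v \<in> fibre E x}"
proof -
  have S: "{(x, v). x \<in> pts X \<and> v \<in> fibre E x} \<inter> fst -` chart E i = {(x, v). x \<in> chart E i \<and> v \<in> fibre E x}"
    using openin_subset[OF chart_open[OF assms(1,2)]] by auto
  have f: "(\<lambda>(x, v). v i $ a) = (\<lambda>p. snd p i $ a)" by auto
  have "(\<lambda>(x, v). v i $ a) \<in> regular (total_space X E)
      ({(x, v). x \<in> pts X \<and> v \<in> fibre E x} \<inter> fst -` chart E i)"
    unfolding total_space_def by (rule regular_generator) (use assms in blast)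
  then show ?thesis unfolding S f .
qed

text \<open>
  Functions from the base are unchanged by a fibrewise map over the identity, so only the fibre
  coordinates of the image have to be tested.
\<close>

lemma morphism_total_space:
  assumes fib: "\<And>x v. x \<in> pts X \<Longrightarrow> v \<in> fibre M x \<Longrightarrow> \<psi> x v \<in> fibre N x"
    and coord: "\<And>j a. j \<in> idx N \<Longrightarrow> a < vrank N \<Longrightarrow>
      (\<lambda>p. \<psi> (fst p) (snd p) j $ a) \<in>
        regular (total_space X M) {(x, v). x \<in> pts X \<and> x \<in> chart N j \<and> v \<in> fibre M x}"
  shows "morphism (total_space X M) (total_space X N) (\<lambda>(x, v). (x, \<psi> x v))"
proof -
  let ?\<psi> = "\<lambda>(x, v). (x, \<psi> x v)"
  let ?S = "{(x, v). x \<in> pts X \<and> v \<in> fibre M x}"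
  have "f \<circ> ?\<psi> \<in> regular (total_space X M) {p \<in> ?S. ?\<psi> p \<in> D}"
    if "(D, f) \<in> {(fst -` U, f \<circ> fst) | U f. openin (zariski X) U \<and> f \<in> regular X U} \<union>
      {(fst -` chart N i, \<lambda>(x, v). v i $ a) | i a. i \<in> idx N \<and> a < vrank N}" for D f
    using that
  proof
    assume "(D, f) \<in> {(fst -` U, f \<circ> fst) | U f. openin (zariski X) U \<and> f \<in> regular X U}"
    then obtain U g where U: "openin (zariski X) U" "g \<in> regular X U" "D = fst -` U" "f = g \<circ> fst"
      by blast
    have "{p \<in> ?S. ?\<psi> p \<in> D} = {(x, v). x \<in> U \<and> v \<in> fibre M x}"
      using openin_subset[OF U(1)] U(3) by auto
    moreover have "f \<circ> ?\<psi> = (\<lambda>p. g (fst p))" using U(4) by auto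
    ultimately show ?thesis using total_space_regular_base[OF U(1,2), of M] by simp
  next
    assume "(D, f) \<in> {(fst -` chart N i, \<lambda>(x, v). v i $ a) | i a. i \<in> idx N \<and> a < vrank N}"
    then obtain j a where j: "j \<in> idx N" "a < vrank N" "D = fst -` chart N j" "f = (\<lambda>(x, v). v j $ a)"
      by blast
    have "{p \<in> ?S. ?\<psi> p \<in> D} = {(x, v). x \<in> pts X \<and> x \<in> chart N j \<and> v \<in> fibre M x}"
      using j(3) by auto
    moreover have "f \<circ> ?\<psi> = (\<lambda>p. \<psi> (fst p) (snd p) j $ a)" using j(4) by auto
    ultimately show ?thesis using coord[OF j(1,2)] by simp
  qed
  then show ?thesis
    unfolding total_space_def[of X N] unfolding total_space_def[of X M] using fib
    by (intro morphism_generate) auto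
qed

text \<open>
  If the frame \<open>A\<close> of \<open>M\<close> is the frame \<open>\<theta> A\<close> of \<open>N\<close> on a smaller open set, then \<open>M\<close> and \<open>N\<close> are the same bundle
  up to isomorphism: a vector of \<open>N\<close> is read in the frames \<open>\<theta> A\<close>, and conversely one frame of \<open>M\<close> at \<open>x\<close>
  determines the coordinates in all frames of \<open>N\<close>.  Both directions are morphisms of total spaces, so
  the two sets of cocycles coincide.  The equality of sets, rather than of cohomology classes, makes
  an arbitrary choice of a representing cocycle the same for \<open>M\<close> and \<open>N\<close>.
\<close>

lemma c1_line_refinement:
  assumes M: "vector_bundle X M" and N: "vector_bundle X N" and rank: "vrank M = vrank N"
    and idx: "\<And>A. A \<in> idx M \<Longrightarrow> \<theta> A \<in> idx N"
    and chart: "\<And>A. A \<in> idx M \<Longrightarrow> chart M A \<subseteq> chart N (\<theta> A)"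
    and trans: "\<And>A B x. A \<in> charts_at M x \<Longrightarrow> B \<in> charts_at M x
      \<Longrightarrow> transition M A B x = transition N (\<theta> A) (\<theta> B) x"
  shows "c1_line X M = c1_line X N"
proof
  let ?r = "vrank N"
  have \<theta>: "\<theta> A \<in> charts_at N x" if "A \<in> charts_at M x" for A x
    using that idx chart by (auto simp: charts_at_def)
  define \<psi> where "\<psi> x v = (\<lambda>A. if A \<in> charts_at M x then v (\<theta> A) else 0\<^sub>v ?r)" for x and v :: "_ \<Rightarrow> complex Matrix.vec"
  define A0 where "A0 x = (SOME A. A \<in> charts_at M x)" for x
  define \<chi> where "\<chi> x w = (\<lambda>B. if B \<in> charts_at N x then transition N B (\<theta> (A0 x)) x *\<^sub>v w (A0 x) else 0\<^sub>v ?r)"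
    for x and w :: "_ \<Rightarrow> complex Matrix.vec"
  have A0: "A0 x \<in> charts_at M x" if "x \<in> pts X" for x
    unfolding A0_def using charts_at_nonempty[OF M that] by (auto intro: someI)
  note cN = transition_carrier[OF N]
  \<comment> \<open>The cocycle condition makes \<open>\<chi>\<close> independent of the chosen frame \<open>A0 x\<close>; so near any point
    it can be computed in a fixed frame \<open>A\<close>, which shows that it is regular.\<close>
  have \<chi>_chart: "\<chi> x w B = transition N B (\<theta> A) x *\<^sub>v w A"
    if w: "w \<in> fibre M x" and A: "A \<in> charts_at M x" and B: "B \<in> charts_at N x" for x w A B
  proof -
    have A0': "A0 x \<in> charts_at M x" using A0 charts_at_pts[OF M A] .
    have "w (A0 x) = transition N (\<theta> (A0 x)) (\<theta> A) x *\<^sub>v w A"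
      using fibre_change_frame[OF w A0' A] trans[OF A0' A] by simp
    moreover have "w A \<in> carrier_vec ?r" using fibre_carrier[OF w] rank by simp
    ultimately show ?thesis
      using B \<theta>[OF A] \<theta>[OF A0'] cN unfolding \<chi>_def
      by (simp add: transition_cocycle[OF N] flip: assoc_mult_mat_vec[of _ ?r ?r _ ?r])
  qed
  show "c1_line X M \<subseteq> c1_line X N"
  proof (rule c1_line_mono[where \<psi> = \<psi>])
    show "morphism (total_space X N) (total_space X M) (\<lambda>(x, v). (x, \<psi> x v))"
    proof (rule morphism_total_space)
      fix x v assume x: "x \<in> pts X" and v: "v \<in> fibre N x"
      show "\<psi> x v \<in> fibre M x"
        using fibre_carrier[OF v] fibre_change_frame[OF v] \<theta> rank
        by (auto simp: fibre_def \<psi>_def trans)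
    next
      fix A a assume A: "A \<in> idx M" "a < vrank M"
      let ?U = "{(x, v). x \<in> pts X \<and> x \<in> chart M A \<and> v \<in> fibre N x}"
      have pts: "chart M A \<subseteq> pts X" using openin_subset[OF chart_open[OF M A(1)]] .
      have "(\<lambda>x. transition M A A x $$ (a, a)) \<in> regular X (chart M A)"
        using transition_regular[OF M A(1) A(1) A(2) A(2)] by simp
      from total_space_regular_base[OF chart_open[OF M A(1)] this, of N]
      have "openin (zariski (total_space X N)) {(x, v). x \<in> chart M A \<and> v \<in> fibre N x}"
        unfolding total_space_def by (rule regular_openin)
      also have "{(x, v). x \<in> chart M A \<and> v \<in> fibre N x} = ?U" using pts by auto
      finally have U: "openin (zariski (total_space X N)) ?U" .
      have "(\<lambda>p. snd p (\<theta> A) $ a) \<in> regular (total_space X N) ?U"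
        using total_space_regular_coordinate[OF N idx[OF A(1)] A(2)[unfolded rank]] U
        unfolding total_space_def by (rule regular_restrict) (use chart[OF A(1)] in auto)
      then show "(\<lambda>p. \<psi> (fst p) (snd p) A $ a) \<in> regular (total_space X N) ?U"
        unfolding total_space_def
        by (rule regular_cong) (use A in \<open>auto simp: \<psi>_def charts_at_def\<close>)
    qed
  next
    fix x v c assume v: "v \<in> fibre N x"
    show "\<psi> x (\<lambda>i. c \<cdot>\<^sub>v v i) = (\<lambda>i. c \<cdot>\<^sub>v \<psi> x v i)"
      by (auto simp: \<psi>_def fun_eq_iff)
  next
    fix x v assume x: "x \<in> pts X" and v: "v \<in> fibre N x" and 0: "\<psi> x v = fibre_zero M"
    show "v = fibre_zero N"
    proof
      fix B
      have "v (\<theta> (A0 x)) = 0\<^sub>v ?r"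
        using fun_cong[OF 0, of "A0 x"] A0[OF x] rank by (simp add: \<psi>_def)
      then have "v B = transition N B (\<theta> (A0 x)) x *\<^sub>v 0\<^sub>v ?r" if "B \<in> charts_at N x"
        using fibre_change_frame[OF v that \<theta>[OF A0[OF x]]] by simp
      then show "v B = fibre_zero N B"
        using fibre_outside[OF v] mult_mat_vec_zero[OF cN] \<theta>[OF A0[OF x]] by (cases "B \<in> charts_at N x") auto
    qed
  next
    fix x show "\<psi> x (fibre_zero N) = fibre_zero M"
      using rank by (auto simp: \<psi>_def)
  qed
  show "c1_line X N \<subseteq> c1_line X M"
  proof (rule c1_line_mono[where \<psi> = \<chi>])
    show "morphism (total_space X M) (total_space X N) (\<lambda>(x, v). (x, \<chi> x v))"
    proof (rule morphism_total_space)
      fix x w assume x: "x \<in> pts X" and w: "w \<in> fibre M x"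
      have wc: "w (A0 x) \<in> carrier_vec ?r" using fibre_carrier[OF w] rank by simp
      have "\<chi> x w i = transition N i j x *\<^sub>v \<chi> x w j"
        if ij: "i \<in> charts_at N x" "j \<in> charts_at N x" for i j
        using \<theta>[OF A0[OF x]] ij cN wc
        by (simp add: \<chi>_def transition_cocycle[OF N] flip: assoc_mult_mat_vec[of _ ?r ?r _ ?r])
      moreover have "\<chi> x w i \<in> carrier_vec ?r" for i
        using mult_mat_vec_carrier[OF cN wc] \<theta>[OF A0[OF x]] by (simp add: \<chi>_def)
      moreover have "\<chi> x w i = 0\<^sub>v ?r" if "i \<notin> charts_at N x" for i
        using that by (simp add: \<chi>_def)
      ultimately show "\<chi> x w \<in> fibre N x" unfolding fibre_def by blast
    next
      fix B a assume B: "B \<in> idx N" "a < vrank N"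
      let ?U = "{(x, v). x \<in> pts X \<and> x \<in> chart N B \<and> v \<in> fibre M x}"
      show "(\<lambda>p. \<chi> (fst p) (snd p) B $ a) \<in> regular (total_space X M) ?U"
        unfolding total_space_def
      proof (rule regular_local, fold total_space_def)
        fix p assume p: "p \<in> ?U"
        then have "fst p \<in> pts X" by auto
        then obtain A where A: "A \<in> charts_at M (fst p)" using A0 by metis
        let ?V = "{(x, v). x \<in> chart M A \<inter> chart N B \<and> v \<in> fibre M x}"
        let ?g = "\<lambda>p. \<Sum>c<?r. transition N B (\<theta> A) (fst p) $$ (a, c) * snd p A $ c"
        have Ai: "A \<in> idx M" using A by (simp add: charts_at_def)
        have base: "(\<lambda>p. transition N B (\<theta> A) (fst p) $$ (a, c)) \<in>
            regular (total_space X M) {(x, v). x \<in> chart N B \<inter> chart N (\<theta> A) \<and> v \<in> fibre M x}"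
          if "c < ?r" for c
          using transition_regular[OF N B(1) idx[OF Ai] B(2) that] B(1) idx[OF Ai]
          by (intro total_space_regular_base) (auto intro: chart_open[OF N])
        have coord: "(\<lambda>p. snd p A $ c) \<in> regular (total_space X M) {(x, v). x \<in> chart M A \<and> v \<in> fibre M x}"
          if "c < ?r" for c
          using total_space_regular_coordinate[OF M Ai] that rank by simp
        have eq: "?V = {(x, v). x \<in> chart N B \<inter> chart N (\<theta> A) \<and> v \<in> fibre M x} \<inter>
            {(x, v). x \<in> chart M A \<and> v \<in> fibre M x}"
          using chart[OF Ai] by auto
        have V: "openin (zariski (total_space X M)) ?V"
          unfolding eq using base[of a] coord[of a] B(2) unfolding total_space_def
          by (intro openin_Int regular_openin) auto
        have "?g \<in> regular (total_space X M) ?V"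
          unfolding total_space_def
        proof (intro regular_sum regular_mult, fold total_space_def)
          fix c assume "c \<in> {..<?r}"
          then have c: "c < ?r" by simp
          show "(\<lambda>p. transition N B (\<theta> A) (fst p) $$ (a, c)) \<in> regular (total_space X M) ?V"
            using base[OF c] V unfolding total_space_def
            by (rule regular_restrict) (use chart[OF Ai] in auto)
          show "(\<lambda>p. snd p A $ c) \<in> regular (total_space X M) ?V"
            using coord[OF c] V unfolding total_space_def by (rule regular_restrict) auto
        qed (rule V)
        moreover have "\<chi> (fst q) (snd q) B $ a = ?g q" if q: "q \<in> ?V" for q
        proof -
          have "A \<in> charts_at M (fst q)" "B \<in> charts_at N (fst q)" "snd q \<in> fibre M (fst q)"
            using q Ai B(1) by (auto simp: charts_at_def)
          then show ?thesis
            using \<chi>_chart[of "snd q" "fst q" A B] cN[of B "fst q" "\<theta> A"] \<theta>[of A "fst q"] B(2)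
              fibre_carrier[of "snd q" M "fst q" A] rank
            by (auto simp: scalar_prod_def row_def lessThan_atLeast0 intro!: sum.cong)
        qed
        ultimately show "\<exists>V g. p \<in> V \<and> V \<subseteq> ?U \<and> g \<in> regular (total_space X M) V \<and>
            (\<forall>q\<in>V. \<chi> (fst q) (snd q) B $ a = g q)"
          using p A openin_subset[OF chart_open[OF N B(1)]]
          by (intro exI[of _ ?V] exI[of _ ?g] conjI) (auto simp: charts_at_def)
      qed
    qed
  next
    fix x w c assume x: "x \<in> pts X" and w: "w \<in> fibre M x"
    show "\<chi> x (\<lambda>i. c \<cdot>\<^sub>v w i) = (\<lambda>i. c \<cdot>\<^sub>v \<chi> x w i)"
      using \<theta>[OF A0[OF x]] cN fibre_carrier[OF w] rank
      by (auto simp: \<chi>_def fun_eq_iff mult_mat_vec[of _ ?r ?r])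
  next
    fix x w assume x: "x \<in> pts X" and w: "w \<in> fibre M x" and 0: "\<chi> x w = fibre_zero N"
    show "w = fibre_zero M"
    proof
      fix A
      have "w A = 0\<^sub>v ?r" if A: "A \<in> charts_at M x"
        using fun_cong[OF 0, of "\<theta> A"] \<chi>_chart[OF w A \<theta>[OF A]] fibre_carrier[OF w, of A] rank
          \<theta>[OF A] by (simp add: transition_self[OF N])
      then show "w A = fibre_zero M A"
        using fibre_outside[OF w] rank by (cases "A \<in> charts_at M x") auto
    qed
  next
    fix x assume "x \<in> pts X"
    then show "\<chi> x (fibre_zero M) = fibre_zero N"
      using \<theta>[OF A0] mult_mat_vec_zero[OF cN] rank by (auto simp: \<chi>_def)
  qed
qed

section \<open>Kernels and standard charts\<close>

lemma mat_eq_if_mult_vec_eq: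
  assumes A: "A \<in> carrier_mat m n" and B: "B \<in> carrier_mat m n"
    and eq: "\<And>u. u \<in> carrier_vec n \<Longrightarrow> A *\<^sub>v u = B *\<^sub>v u"
  shows "A = (B :: 'b :: semiring_1 mat)"
proof (rule eq_matI)
  fix i j assume ij: "i < dim_row B" "j < dim_col B"
  then have "(A *\<^sub>v unit_vec n j) $ i = A $$ (i, j)" "(B *\<^sub>v unit_vec n j) $ i = B $$ (i, j)"
    using A B by (auto simp: row_def)
  then show "A $$ (i, j) = B $$ (i, j)" using eq by simp
qed (use A B in auto)

text \<open>Right multiplication by this matrix selects the columns with the indices \<open>J\<close>.\<close>

definition column_selection :: "nat \<Rightarrow> nat list \<Rightarrow> complex Matrix.mat" where
  "column_selection r J = Matrix.mat r (length J) (\<lambda>(c, b). if c = J ! b then 1 else 0)"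

lemma column_selection_carrier: "length J = k \<Longrightarrow> column_selection r J \<in> carrier_mat r k"
  by (simp add: column_selection_def)

lemma mult_column_selection:
  assumes "M \<in> carrier_mat k r" "set J \<subseteq> {..<r}"
  shows "M * column_selection r J = Matrix.mat k (length J) (\<lambda>(a, b). M $$ (a, J ! b))"
proof (rule eq_matI, goal_cases)
  case (1 a b)
  then have "J ! b < r" using assms(2) nth_mem by fastforce
  with 1 assms(1) show ?case
    by (auto simp: column_selection_def scalar_prod_def row_def if_distrib[of "\<lambda>x. _ * x"] cong: if_cong)
qed (use assms in \<open>auto simp: column_selection_def\<close>)

lemma unit_columns_iff:
  assumes "M \<in> carrier_mat k r" "length J = k" "set J \<subseteq> {..<r}"
  shows "(\<forall>a<k. Matrix.col M (J ! a) = unit_vec k a) \<longleftrightarrow> M * column_selection r J = 1\<^sub>m k"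
proof -
  have J: "J ! b < r" if "b < k" for b using assms(2,3) nth_mem that by fastforce
  show ?thesis
    unfolding mult_column_selection[OF assms(1,3)]
    using assms(1,2) J by (auto simp: mat_eq_iff vec_eq_iff)
qed

text \<open>
  The kernel of \<open>N\<close> is complementary to the image of its section \<open>S\<close>.  A map that vanishes on this
  kernel is therefore determined by its restriction to that image, through the projector \<open>S N\<close>.
\<close>

lemma factor_through_section:
  assumes E: "vector_bundle X E" and i: "i \<in> charts_at E x" and j: "j \<in> charts_at E x"
    and M: "M \<in> carrier_mat l (vrank E)" and N: "N \<in> carrier_mat k (vrank E)"
    and S: "S \<in> carrier_mat (vrank E) k" and NS: "N * S = 1\<^sub>m k"
    and ker: "kernel_at E k x j N \<subseteq> kernel_at E l x i M"
  shows "M * transition E i j x * S * N = M * transition E i j x"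
proof (rule mat_eq_if_mult_vec_eq)
  let ?r = "vrank E" and ?A = "M * transition E i j x"
  have g: "transition E i j x \<in> carrier_mat ?r ?r" using transition_carrier[OF E i j] .
  have A: "?A \<in> carrier_mat l ?r" using M g by (rule mult_carrier_mat)
  show "?A * S * N \<in> carrier_mat l ?r" "?A \<in> carrier_mat l ?r"
    using A S N by (auto intro: mult_carrier_mat)
  fix u :: "complex Matrix.vec" assume u: "u \<in> carrier_vec ?r"
  let ?s = "S *\<^sub>v (N *\<^sub>v u)"
  have Nu: "N *\<^sub>v u \<in> carrier_vec k" using N u by simp
  have s: "?s \<in> carrier_vec ?r" using S Nu by simp
  have "N *\<^sub>v ?s = (N * S) *\<^sub>v (N *\<^sub>v u)" using assoc_mult_mat_vec[OF N S Nu] by simp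
  also have "\<dots> = N *\<^sub>v u" using NS Nu by simp
  finally have "N *\<^sub>v (u - ?s) = 0\<^sub>v k" using mult_minus_distrib_mat_vec[OF N u s] Nu by simp
  moreover obtain v where v: "v \<in> fibre E x" "v j = u - ?s"
    using fibre_vector_exists[OF E j, of "u - ?s"] u s by auto
  ultimately have "M *\<^sub>v v i = 0\<^sub>v l" using ker by (auto simp: kernel_at_def)
  then have "?A *\<^sub>v (u - ?s) = 0\<^sub>v l"
    using fibre_change_frame[OF v(1) i j] v(2) assoc_mult_mat_vec[OF M g] u s by simp
  then have *: "?A *\<^sub>v u - ?A *\<^sub>v ?s = 0\<^sub>v l" using mult_minus_distrib_mat_vec[OF A u s] by simp
  have "?A *\<^sub>v u = ?A *\<^sub>v ?s"
  proof (rule eq_vecI)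
    fix a assume "a < dim_vec (?A *\<^sub>v ?s)"
    then have a: "a < l" using A M by simp
    then have "(?A *\<^sub>v u - ?A *\<^sub>v ?s) $ a = 0" using * by simp
    moreover have "(?A *\<^sub>v u - ?A *\<^sub>v ?s) $ a = (?A *\<^sub>v u) $ a - (?A *\<^sub>v ?s) $ a"
      using a A M by (intro index_minus_vec) simp
    ultimately show "(?A *\<^sub>v u) $ a = (?A *\<^sub>v ?s) $ a" by simp
  qed simp
  also have "\<dots> = (?A * S) *\<^sub>v (N *\<^sub>v u)" using assoc_mult_mat_vec[OF A S Nu] by simp
  also have "\<dots> = (?A * S * N) *\<^sub>v u"
    using assoc_mult_mat_vec[OF mult_carrier_mat[OF A S] N u] by simp
  finally show "(?A * S * N) *\<^sub>v u = ?A *\<^sub>v u" by simp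
qed

lemma kernel_at_change_frame:
  assumes E: "vector_bundle X E" and ij: "i \<in> charts_at E x" "j \<in> charts_at E x"
    and M: "M \<in> carrier_mat k (vrank E)"
  shows "kernel_at E k x i M = kernel_at E k x j (M * transition E i j x)"
  unfolding kernel_at_def
  using fibre_change_frame[OF _ ij] fibre_carrier assoc_mult_mat_vec[OF M transition_carrier[OF E ij]]
  by (metis (no_types, lifting))

lemma kernel_at_mult_left:
  assumes "T \<in> carrier_mat k k" "T' \<in> carrier_mat k k" "T' * T = 1\<^sub>m k" and M: "M \<in> carrier_mat k (vrank E)"
  shows "kernel_at E k x i (T * M) = kernel_at E k x i M"
proof -
  have "(T * M) *\<^sub>v v i = 0\<^sub>v k \<longleftrightarrow> M *\<^sub>v v i = 0\<^sub>v k" if "v \<in> fibre E x" for v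
  proof -
    have v: "v i \<in> carrier_vec (vrank E)" using fibre_carrier[OF that] .
    then have Mv: "M *\<^sub>v v i \<in> carrier_vec k" using M by simp
    have "(T * M) *\<^sub>v v i = T *\<^sub>v (M *\<^sub>v v i)" using assoc_mult_mat_vec[OF assms(1) M v] .
    moreover have "T' *\<^sub>v (T *\<^sub>v (M *\<^sub>v v i)) = M *\<^sub>v v i"
      using assoc_mult_mat_vec[OF assms(2,1) Mv] assms(3) Mv by simp
    ultimately show ?thesis
      using mult_mat_vec_zero[OF assms(1)] mult_mat_vec_zero[OF assms(2)] by metis
  qed
  then show ?thesis by (auto simp: kernel_at_def)
qed

lemma Gr_index_iff: "(i, J) \<in> Gr_index k E \<longleftrightarrow> i \<in> idx E \<and> length J = k \<and> set J \<subseteq> {..<vrank E}"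
  by (simp add: Gr_index_def)

lemma normal_matrix_iff:
  assumes "(i, J) \<in> Gr_index k E"
  shows "normal_matrix k E (i, J) (x, K) M \<longleftrightarrow> M \<in> carrier_mat k (vrank E) \<and>
    K = kernel_at E k x i M \<and> M * column_selection (vrank E) J = 1\<^sub>m k"
  using assms unit_columns_iff[of M k "vrank E" J] by (auto simp: normal_matrix_def Gr_index_iff)

lemma normal_matrix_unique:
  assumes E: "vector_bundle X E" and J: "(i, J) \<in> Gr_index k E" and i: "i \<in> charts_at E x"
    and M: "normal_matrix k E (i, J) (x, K) M" and N: "normal_matrix k E (i, J) (x, K) N"
  shows "M = N"
proof -
  let ?S = "column_selection (vrank E) J"
  have M': "M \<in> carrier_mat k (vrank E)" "M * ?S = 1\<^sub>m k" "K = kernel_at E k x i M"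
    using M by (simp_all add: normal_matrix_iff[OF J])
  have N': "N \<in> carrier_mat k (vrank E)" "N * ?S = 1\<^sub>m k" "K = kernel_at E k x i N"
    using N by (simp_all add: normal_matrix_iff[OF J])
  have S: "?S \<in> carrier_mat (vrank E) k" using J by (auto simp: Gr_index_iff column_selection_carrier)
  have "M * transition E i i x * ?S * N = M * transition E i i x"
    by (rule factor_through_section[OF E i i M'(1) N'(1) S N'(2)]) (use M' N' in simp)
  then show ?thesis using M' N'(1) by (simp add: transition_self[OF E i])
qed

lemma Gr_matrix_eq:
  assumes "vector_bundle X E" "(i, J) \<in> Gr_index k E" "i \<in> charts_at E x" "normal_matrix k E (i, J) (x, K) M"
  shows "Gr_matrix k E (i, J) (x, K) = M"
  unfolding Gr_matrix_def using assms by (blast intro: normal_matrix_unique)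

lemma Gr_matrix_chart:
  assumes E: "vector_bundle X E" and J: "(i, J) \<in> Gr_index k E" and p: "(x, K) \<in> Gr_chart X k E (i, J)"
  shows "i \<in> charts_at E x" "Gr_matrix k E (i, J) (x, K) \<in> carrier_mat k (vrank E)"
    "K = kernel_at E k x i (Gr_matrix k E (i, J) (x, K))"
    "Gr_matrix k E (i, J) (x, K) * column_selection (vrank E) J = 1\<^sub>m k"
proof -
  show i: "i \<in> charts_at E x" using p by (simp add: Gr_chart_def)
  obtain M where "normal_matrix k E (i, J) (x, K) M" using p by (auto simp: Gr_chart_def)
  with Gr_matrix_eq[OF E J i this] have "normal_matrix k E (i, J) (x, K) (Gr_matrix k E (i, J) (x, K))"
    by simp
  then show "Gr_matrix k E (i, J) (x, K) \<in> carrier_mat k (vrank E)"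
    "K = kernel_at E k x i (Gr_matrix k E (i, J) (x, K))"
    "Gr_matrix k E (i, J) (x, K) * column_selection (vrank E) J = 1\<^sub>m k"
    by (simp_all add: normal_matrix_iff[OF J])
qed

lemma Gr_chart_points: "Gr_chart X k E iJ \<subseteq> Gr_points X k E"
  by (auto simp: Gr_chart_def)

lemma Gr_points_pts: "p \<in> Gr_points X k E \<Longrightarrow> fst p \<in> pts X"
  by (auto simp: Gr_points_def)

lemma right_inverse_if_surjective:
  assumes M: "M \<in> carrier_mat k r" and surj: "(\<lambda>v. M *\<^sub>v v) ` carrier_vec r = carrier_vec k"
  obtains B where "B \<in> carrier_mat r k" "M * B = (1\<^sub>m k :: complex mat)"
proof -
  have "\<exists>w. w \<in> carrier_vec r \<and> M *\<^sub>v w = unit_vec k a" for a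
    using surj unit_vec_carrier[of k a] by (metis imageE)
  then obtain w where w: "\<And>a. w a \<in> carrier_vec r" "\<And>a. M *\<^sub>v w a = unit_vec k a" by metis
  let ?B = "mat_of_cols r (map w [0..<k])"
  have B: "?B \<in> carrier_mat r k" using mat_of_cols_carrier(1)[of r "map w [0..<k]"] by simp
  have "M * ?B = 1\<^sub>m k"
  proof (rule eq_matI)
    fix a b assume "a < dim_row (1\<^sub>m k :: complex mat)" "b < dim_col (1\<^sub>m k :: complex mat)"
    then have ab: "a < k" "b < k" by simp_all
    then have "(M * ?B) $$ (a, b) = (M *\<^sub>v w b) $ a"
      using M B w(1) by (simp add: col_mat_of_cols)
    then show "(M * ?B) $$ (a, b) = 1\<^sub>m k $$ (a, b)" using w ab by (simp add: unit_vec_def)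
  qed (use M in auto)
  with B show ?thesis by (rule that)
qed

lemma surjective_if_right_inverse:
  assumes M: "M \<in> carrier_mat k r" and B: "B \<in> carrier_mat r k" and MB: "M * B = (1\<^sub>m k :: complex mat)"
  shows "(\<lambda>v. M *\<^sub>v v) ` carrier_vec r = carrier_vec k"
proof
  show "carrier_vec k \<subseteq> (\<lambda>v. M *\<^sub>v v) ` carrier_vec r"
  proof
    fix u :: "complex Matrix.vec" assume u: "u \<in> carrier_vec k"
    then have "M *\<^sub>v (B *\<^sub>v u) = u" using assoc_mult_mat_vec[OF M B u] MB by simp
    then show "u \<in> (\<lambda>v. M *\<^sub>v v) ` carrier_vec r" using B u by (metis imageI mult_mat_vec_carrier)
  qed
qed (use M in auto)

text \<open>
  A surjective matrix has an invertible maximal minor: \<open>1 = det (M B)\<close> expands multilinearly into a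
  combination of the minors of \<open>M\<close>.
\<close>

lemma invertible_minor:
  assumes M: "M \<in> carrier_mat k r" and B: "B \<in> carrier_mat r k" and MB: "M * B = (1\<^sub>m k :: complex mat)"
  obtains J where "length J = k" "set J \<subseteq> {..<r}" "Determinant.det (M * column_selection r J) \<noteq> 0"
proof -
  let ?a = "\<lambda>i c. B $$ (c, i) \<cdot>\<^sub>v Matrix.col M c"
  let ?F = "{f. (\<forall>i\<in>{0..<k}. f i \<in> {0..<r}) \<and> (\<forall>i. i \<notin> {0..<k} \<longrightarrow> f i = i)}"
  have a: "?a \<in> {0..<k} \<rightarrow> {0..<r} \<rightarrow> carrier_vec k" using M by auto
  \<comment> \<open>The determinant is expanded along rows, so this is the transpose of \<open>M * B = 1\<close>.\<close>
  have "mat\<^sub>r k k (\<lambda>i. finsum_vec TYPE(complex) k (?a i) {0..<r}) = 1\<^sub>m k"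
  proof (rule eq_matI)
    fix i j assume "i < dim_row (1\<^sub>m k :: complex mat)" "j < dim_col (1\<^sub>m k :: complex mat)"
    then have ij: "i < k" "j < k" by simp_all
    have "finsum_vec TYPE(complex) k (?a i) {0..<r} $ j = (\<Sum>c\<in>{0..<r}. ?a i c $ j)"
      using ij M by (intro index_finsum_vec) auto
    also have "\<dots> = (M * B) $$ (j, i)"
      using ij M B by (auto simp: scalar_prod_def mult.commute intro!: sum.cong)
    finally show "mat\<^sub>r k k (\<lambda>i. finsum_vec TYPE(complex) k (?a i) {0..<r}) $$ (i, j) = 1\<^sub>m k $$ (i, j)"
      using ij MB by auto
  qed auto
  then have "(\<Sum>f\<in>?F. Determinant.det (mat\<^sub>r k k (\<lambda>i. ?a i (f i)))) = 1"
    using det_linear_rows_sum[OF _ a] by simp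
  then obtain f where f: "f \<in> ?F" and "Determinant.det (mat\<^sub>r k k (\<lambda>i. ?a i (f i))) \<noteq> 0"
    by (metis (no_types, lifting) sum.neutral zero_neq_one)
  moreover have "Determinant.det (mat\<^sub>r k k (\<lambda>i. ?a i (f i)))
      = (\<Prod>i\<in>{0..<k}. B $$ (f i, i)) * Determinant.det (mat\<^sub>r k k (\<lambda>i. Matrix.col M (f i)))"
    using M f by (intro det_rows_mul) auto
  ultimately have det: "Determinant.det (mat\<^sub>r k k (\<lambda>i. Matrix.col M (f i))) \<noteq> 0" by auto
  let ?J = "map f [0..<k]"
  have J: "length ?J = k" "set ?J \<subseteq> {..<r}" using f by auto
  have C: "M * column_selection r ?J \<in> carrier_mat k k"
    using M column_selection_carrier[OF J(1), of r] by (rule mult_carrier_mat)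
  have "mat\<^sub>r k k (\<lambda>i. Matrix.col M (f i)) = transpose_mat (M * column_selection r ?J)"
    unfolding mult_column_selection[OF M J(2)] using M f by (intro eq_matI) auto
  then have "Determinant.det (M * column_selection r ?J) \<noteq> 0" using det det_transpose[OF C] by simp
  with J show ?thesis by (rule that)
qed

section \<open>The universal quotient bundle\<close>

lemma Gr_chartI:
  assumes E: "vector_bundle X E" and J: "(i, J) \<in> Gr_index k E" and i: "i \<in> charts_at E x"
    and M: "M \<in> carrier_mat k (vrank E)" and K: "K = kernel_at E k x i M"
    and MS: "M * column_selection (vrank E) J = 1\<^sub>m k"
  shows "(x, K) \<in> Gr_chart X k E (i, J)" and "Gr_matrix k E (i, J) (x, K) = M"
proof -
  have N: "normal_matrix k E (i, J) (x, K) M" using J M K MS by (simp add: normal_matrix_iff)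
  have "column_selection (vrank E) J \<in> carrier_mat (vrank E) k"
    using J by (simp add: Gr_index_iff column_selection_carrier)
  then have "(\<lambda>v. M *\<^sub>v v) ` carrier_vec (vrank E) = carrier_vec k"
    using surjective_if_right_inverse M MS by blast
  then have "(x, K) \<in> Gr_points X k E"
    using charts_at_pts[OF E i] i M K unfolding Gr_points_def quotient_kernels_def by blast
  with N i show "(x, K) \<in> Gr_chart X k E (i, J)" by (auto simp: Gr_chart_def)
  show "Gr_matrix k E (i, J) (x, K) = M" using Gr_matrix_eq[OF E J i N] .
qed

text \<open>
  Multiplying a surjection by the inverse of an invertible maximal minor turns the columns of that
  minor into unit vectors and keeps the kernel.
\<close>

lemma Gr_charts_cover:
  assumes E: "vector_bundle X E"
  shows "(\<Union>iJ\<in>Gr_index k E. Gr_chart X k E iJ) = Gr_points X k E"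
proof
  show "Gr_points X k E \<subseteq> (\<Union>iJ\<in>Gr_index k E. Gr_chart X k E iJ)"
  proof
    fix p assume "p \<in> Gr_points X k E"
    then obtain x i M where p: "p = (x, kernel_at E k x i M)" and i: "i \<in> charts_at E x"
      and M: "M \<in> carrier_mat k (vrank E)"
      and surj: "(\<lambda>v. M *\<^sub>v v) ` carrier_vec (vrank E) = carrier_vec k"
      by (auto simp: Gr_points_def quotient_kernels_def)
    obtain B where "B \<in> carrier_mat (vrank E) k" "M * B = 1\<^sub>m k"
      using right_inverse_if_surjective[OF M surj] .
    then obtain J where J: "length J = k" "set J \<subseteq> {..<vrank E}"
      "Determinant.det (M * column_selection (vrank E) J) \<noteq> 0"
      using invertible_minor[OF M] by metis
    let ?S = "column_selection (vrank E) J"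
    let ?T = "inverse (Determinant.det (M * ?S)) \<cdot>\<^sub>m adj_mat (M * ?S)"
    have S: "?S \<in> carrier_mat (vrank E) k" using J by (simp add: column_selection_carrier)
    have MS: "M * ?S \<in> carrier_mat k k" using M S by (rule mult_carrier_mat)
    have T: "?T \<in> carrier_mat k k" using adj_mat(1)[OF MS] by simp
    have "?T * (M * ?S) = 1\<^sub>m k"
      using adj_mat[OF MS] J(3) by (simp add: mult_smult_assoc_mat[OF adj_mat(1)[OF MS] MS])
        (auto intro!: eq_matI)
    moreover have "(M * ?S) * ?T = 1\<^sub>m k"
      using adj_mat[OF MS] J(3) by (simp add: mult_smult_distrib[OF MS adj_mat(1)[OF MS]])
        (auto intro!: eq_matI)
    ultimately have "kernel_at E k x i (?T * M) = kernel_at E k x i M" "?T * M * ?S = 1\<^sub>m k"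
      using kernel_at_mult_left[OF T MS _ M] assoc_mult_mat[OF T M S] by simp_all
    moreover have iJ: "(i, J) \<in> Gr_index k E" using i J by (simp add: Gr_index_iff charts_at_def)
    ultimately have "p \<in> Gr_chart X k E (i, J)"
      using Gr_chartI(1)[OF E iJ i mult_carrier_mat[OF T M]] p by simp
    with iJ show "p \<in> (\<Union>iJ\<in>Gr_index k E. Gr_chart X k E iJ)" by blast
  qed
qed (use Gr_chart_points in blast)

lemma pts_Gr [simp]: "pts (Gr X k E) = Gr_points X k E"
  by (simp add: Gr_def)

lemma Gr_regular_base:
  assumes "openin (zariski X) U" "f \<in> regular X U"
  shows "(\<lambda>p. f (fst p)) \<in> regular (Gr X k E) {p \<in> Gr_points X k E. fst p \<in> U}"
proof -
  have "f \<circ> fst \<in> regular (Gr X k E) (Gr_points X k E \<inter> fst -` U)"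
    unfolding Gr_def by (rule regular_generator) (use assms in blast)
  moreover have "Gr_points X k E \<inter> fst -` U = {p \<in> Gr_points X k E. fst p \<in> U}" by auto
  ultimately show ?thesis by (simp add: o_def)
qed

lemma Gr_regular_matrix:
  assumes "iJ \<in> Gr_index k E" "a < k" "b < vrank E"
  shows "(\<lambda>p. Gr_matrix k E iJ p $$ (a, b)) \<in> regular (Gr X k E) (Gr_chart X k E iJ)"
proof -
  have "(\<lambda>p. Gr_matrix k E iJ p $$ (a, b)) \<in> regular (Gr X k E) (Gr_points X k E \<inter> Gr_chart X k E iJ)"
    unfolding Gr_def by (rule regular_generator) (use assms in blast)
  then show ?thesis by (simp add: Int_absorb1 Gr_chart_points)
qed

text \<open>A chart is open as the domain of an entry of its matrix; such an entry exists only for \<open>k \<ge> 1\<close>.\<close>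

lemma openin_Gr_chart:
  assumes "iJ \<in> Gr_index k E" "1 \<le> k"
  shows "openin (zariski (Gr X k E)) (Gr_chart X k E iJ)"
proof -
  obtain i J where "iJ = (i, J)" "length J = k" "set J \<subseteq> {..<vrank E}"
    using assms(1) by (auto simp: Gr_index_def)
  with assms(2) have "0 < vrank E" by (cases J) auto
  with assms Gr_regular_matrix[of iJ k E 0 0 X] show ?thesis
    unfolding Gr_def by (auto intro: regular_openin)
qed

lemma universal_quotient_simps [simp]:
  "vrank (universal_quotient X k E) = k"
  "idx (universal_quotient X k E) = Gr_index k E"
  "chart (universal_quotient X k E) = Gr_chart X k E"
  by (simp_all add: universal_quotient_def)

lemma universal_quotient_transition:
  assumes E: "vector_bundle X E" and J: "(i, J) \<in> Gr_index k E" and J': "(j, J') \<in> Gr_index k E"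
    and p: "p \<in> Gr_chart X k E (i, J)" "p \<in> Gr_chart X k E (j, J')"
  shows "transition (universal_quotient X k E) (i, J) (j, J') p
    = Gr_matrix k E (i, J) p * transition E i j (fst p) * column_selection (vrank E) J'"
proof -
  obtain x K where x: "p = (x, K)" by (cases p)
  have "Gr_matrix k E (i, J) p * transition E i j (fst p) \<in> carrier_mat k (vrank E)"
    using Gr_matrix_chart[OF E J p(1)[unfolded x]] Gr_matrix_chart[OF E J' p(2)[unfolded x]] x
    by (auto intro: mult_carrier_mat transition_carrier[OF E])
  then show ?thesis
    using J' by (simp add: universal_quotient_def mult_column_selection Gr_index_iff)
qed

text \<open>
  With \<open>M\<close>, \<open>M'\<close> the normal matrices of one quotient in two charts and \<open>S'\<close> the column selection of the
  second, \<open>M g S'\<close> is the transition, where \<open>g\<close> is the one of \<open>E\<close>.  In a product of two transitions the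
  projector \<open>S' M'\<close> stands next to \<open>M g\<close>, which absorbs it because both have the same kernel.
\<close>

lemma universal_quotient_vector_bundle:
  assumes E: "vector_bundle X E" and k: "1 \<le> k"
  shows "vector_bundle (Gr X k E) (universal_quotient X k E)"
proof -
  let ?r = "vrank E" and ?Q = "universal_quotient X k E"
  let ?G = "Gr_matrix k E" and ?C = "Gr_chart X k E" and ?S = "column_selection (vrank E)"
  have S: "?S J \<in> carrier_mat ?r k" if "(i, J) \<in> Gr_index k E" for i J
    using that by (simp add: Gr_index_iff column_selection_carrier)
  have trans_carrier: "transition ?Q iJ jJ' p \<in> carrier_mat k k" for iJ jJ' p
    by (simp add: universal_quotient_def)
  have regular: "(\<lambda>p. transition ?Q iJ jJ' p $$ (a, b)) \<in> regular (Gr X k E) (?C iJ \<inter> ?C jJ')"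
    if iJ: "iJ \<in> Gr_index k E" and jJ': "jJ' \<in> Gr_index k E" and ab: "a < k" "b < k" for iJ jJ' a b
  proof -
    obtain i J j J' where ij: "iJ = (i, J)" "jJ' = (j, J')" by (cases iJ, cases jJ')
    have idx: "i \<in> idx E" "j \<in> idx E" using iJ jJ' ij by (simp_all add: Gr_index_iff)
    have c: "J' ! b < ?r" using jJ' ij ab(2) nth_mem by (fastforce simp: Gr_index_iff)
    let ?U = "?C iJ \<inter> ?C jJ'"
    have U: "openin (zariski (Gr X k E)) ?U" using openin_Gr_chart[OF _ k] iJ jJ' by blast
    have sub: "?U \<subseteq> {p \<in> Gr_points X k E. fst p \<in> chart E i \<inter> chart E j}"
      unfolding ij by (auto simp: Gr_chart_def charts_at_def)
    have "(\<lambda>p. \<Sum>d\<in>{0..<?r}. ?G iJ p $$ (a, d) * transition E i j (fst p) $$ (d, J' ! b)) \<in> regular (Gr X k E) ?U"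
      unfolding Gr_def
    proof (intro regular_sum regular_mult, fold Gr_def)
      fix d assume "d \<in> {0..<?r}"
      then have d: "d < ?r" by simp
      show "(\<lambda>p. ?G iJ p $$ (a, d)) \<in> regular (Gr X k E) ?U"
        using Gr_regular_matrix[OF iJ ab(1) d] U unfolding Gr_def by (rule regular_restrict) simp
      have "(\<lambda>p. transition E i j (fst p) $$ (d, J' ! b)) \<in>
          regular (Gr X k E) {p \<in> Gr_points X k E. fst p \<in> chart E i \<inter> chart E j}"
        using chart_open[OF E] idx by (intro Gr_regular_base openin_Int transition_regular[OF E] d c) auto
      then show "(\<lambda>p. transition E i j (fst p) $$ (d, J' ! b)) \<in> regular (Gr X k E) ?U"
        using U unfolding Gr_def by (rule regular_restrict) (rule sub[unfolded Gr_def])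
    qed (rule U)
    moreover have "transition ?Q iJ jJ' p $$ (a, b)
        = (\<Sum>d\<in>{0..<?r}. ?G iJ p $$ (a, d) * transition E i j (fst p) $$ (d, J' ! b))" if p: "p \<in> ?U" for p
    proof -
      obtain x K where x: "p = (x, K)" by (cases p)
      have G: "?G iJ p \<in> carrier_mat k ?r" and i: "i \<in> charts_at E x"
        using Gr_matrix_chart[OF E, of i J k x K] iJ p ij x by auto
      have "j \<in> charts_at E x" using Gr_matrix_chart[OF E, of j J' k x K] jJ' p ij x by auto
      then have "transition E i j (fst p) \<in> carrier_mat ?r ?r" using transition_carrier[OF E i] x by simp
      with G c ab show ?thesis
        by (simp add: universal_quotient_def ij scalar_prod_def)
    qed
    ultimately show ?thesis unfolding Gr_def by (rule regular_cong)
  qed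
  have self: "transition ?Q iJ iJ p = 1\<^sub>m k" if iJ: "iJ \<in> Gr_index k E" and p: "p \<in> ?C iJ" for iJ p
  proof -
    obtain i J x K where ij: "iJ = (i, J)" "p = (x, K)" by (cases iJ, cases p)
    note G = Gr_matrix_chart[OF E iJ[unfolded ij] p[unfolded ij]]
    show ?thesis
      using universal_quotient_transition[OF E, of i J k i J p] iJ p G ij
      by (simp add: transition_self[OF E])
  qed
  have cocycle: "transition ?Q iJ jJ' p * transition ?Q jJ' lL p = transition ?Q iJ lL p"
    if idx: "iJ \<in> Gr_index k E" "jJ' \<in> Gr_index k E" "lL \<in> Gr_index k E"
      and p: "p \<in> ?C iJ" "p \<in> ?C jJ'" "p \<in> ?C lL" for iJ jJ' lL p
  proof -
    obtain i J j J' l L x K where ij: "iJ = (i, J)" "jJ' = (j, J')" "lL = (l, L)" "p = (x, K)"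
      by (cases iJ, cases jJ', cases lL, cases p)
    note G = Gr_matrix_chart[OF E idx(1)[unfolded ij] p(1)[unfolded ij]]
    note G' = Gr_matrix_chart[OF E idx(2)[unfolded ij] p(2)[unfolded ij]]
    note G'' = Gr_matrix_chart[OF E idx(3)[unfolded ij] p(3)[unfolded ij]]
    note S' = S[OF idx(2)[unfolded ij]] and S'' = S[OF idx(3)[unfolded ij]]
    let ?M = "?G (i, J) (x, K)" and ?M' = "?G (j, J') (x, K)"
    let ?g = "transition E i j x" and ?h = "transition E j l x"
    have gh: "?g \<in> carrier_mat ?r ?r" "?h \<in> carrier_mat ?r ?r" "?g * ?h = transition E i l x"
      using G(1) G'(1) G''(1) transition_carrier[OF E] transition_cocycle[OF E] by auto
    have Mg: "?M * ?g \<in> carrier_mat k ?r" using G(2) gh(1) by (rule mult_carrier_mat)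
    have hS: "?h * ?S L \<in> carrier_mat ?r k" using gh(2) S'' by (rule mult_carrier_mat)
    have "transition ?Q iJ jJ' p * transition ?Q jJ' lL p = (?M * ?g * ?S J') * (?M' * (?h * ?S L))"
      using universal_quotient_transition[OF E] idx p ij assoc_mult_mat[OF G'(2) gh(2) S''] by simp
    also have "\<dots> = (?M * ?g * ?S J' * ?M') * (?h * ?S L)"
      using assoc_mult_mat[OF mult_carrier_mat[OF Mg S'] G'(2) hS] by simp
    also have "?M * ?g * ?S J' * ?M' = ?M * ?g"
      by (rule factor_through_section[OF E G(1) G'(1) G(2) G'(2) S' G'(4)])
        (use G(3) G'(3) in simp)
    also have "?M * ?g * (?h * ?S L) = ?M * (?g * ?h) * ?S L"
      using assoc_mult_mat[OF Mg gh(2) S''] assoc_mult_mat[OF G(2) gh(1,2)] by simp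
    also have "\<dots> = transition ?Q iJ lL p"
      using universal_quotient_transition[OF E] idx p ij gh(3) by simp
    finally show ?thesis .
  qed
  show ?thesis
    unfolding vector_bundle_def universal_quotient_simps pts_Gr
    using openin_Gr_chart[OF _ k] Gr_charts_cover[OF E] trans_carrier regular self cocycle by auto
qed

section \<open>Pulling back line bundles\<close>

lemma pullback_simps [simp]:
  "vrank (pullback Y \<phi> E) = vrank E" "idx (pullback Y \<phi> E) = idx E"
  "chart (pullback Y \<phi> E) = (\<lambda>i. {y \<in> pts Y. \<phi> y \<in> chart E i})"
  "transition (pullback Y \<phi> E) = (\<lambda>i j y. transition E i j (\<phi> y))"
  by (simp_all add: pullback_def)

lemma pullback_vector_bundle:
  assumes E: "vector_bundle X E" and \<phi>: "morphism Y X \<phi>"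
  shows "vector_bundle Y (pullback Y \<phi> E)"
proof -
  have maps: "\<phi> y \<in> pts X" if "y \<in> pts Y" for y
    using \<phi> that by (auto simp: morphism_def continuous_map_def)
  have op: "openin (zariski Y) {y \<in> pts Y. \<phi> y \<in> U}" if "openin (zariski X) U" for U
    using \<phi> that by (auto simp: morphism_def continuous_map)
  have regular: "(\<lambda>y. transition E i j (\<phi> y) $$ (a, b)) \<in>
      regular Y ({y \<in> pts Y. \<phi> y \<in> chart E i} \<inter> {y \<in> pts Y. \<phi> y \<in> chart E j})"
    if "i \<in> idx E" "j \<in> idx E" "a < vrank E" "b < vrank E" for i j a b
  proof -
    have "(\<lambda>x. transition E i j x $$ (a, b)) \<circ> \<phi> \<in> regular Y {y \<in> pts Y. \<phi> y \<in> chart E i \<inter> chart E j}"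
      using \<phi> transition_regular[OF E that] chart_open[OF E that(1)] chart_open[OF E that(2)]
      unfolding morphism_def by blast
    moreover have "{y \<in> pts Y. \<phi> y \<in> chart E i \<inter> chart E j} =
        {y \<in> pts Y. \<phi> y \<in> chart E i} \<inter> {y \<in> pts Y. \<phi> y \<in> chart E j}" by auto
    ultimately show ?thesis by (simp add: o_def)
  qed
  have cover: "(\<Union>i\<in>idx E. {y \<in> pts Y. \<phi> y \<in> chart E i}) = pts Y"
    using maps charts_cover[OF E] by blast
  show ?thesis
    unfolding vector_bundle_def pullback_simps
    using op[OF chart_open[OF E]] cover regular transition_carrier[OF E] transition_self[OF E]
      transition_cocycle[OF E]
    by (auto simp: charts_at_def)
qed

section \<open>Composing quotients\<close>

text \<open>
  The row \<open>h\<close> represents in the frame \<open>i\<close> the functional that \<open>n\<close> represents in the frame \<open>j\<close>.  The basis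
  vector \<open>e\<^sub>b\<close> generates the one-dimensional quotient iff its image \<open>h\<^sub>b\<close> is non-zero, and the
  normal matrix is then \<open>h / h\<^sub>b\<close>.
\<close>

lemma projective_chart:
  assumes E: "vector_bundle X E" and i: "i \<in> charts_at E x" and j: "j \<in> charts_at E x"
    and n: "n \<in> carrier_mat 1 (vrank E)" and b: "b < vrank E" and K: "K = kernel_at E 1 x j n"
  defines "h \<equiv> n * transition E j i x"
  shows "(x, K) \<in> Gr_chart X 1 E (i, [b]) \<longleftrightarrow> h $$ (0, b) \<noteq> 0"
    and "h $$ (0, b) \<noteq> 0 \<Longrightarrow> c < vrank E
      \<Longrightarrow> Gr_matrix 1 E (i, [b]) (x, K) $$ (0, c) = h $$ (0, c) * inverse (h $$ (0, b))"
proof -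
  let ?r = "vrank E"
  have g: "transition E j i x \<in> carrier_mat ?r ?r" using transition_carrier[OF E j i] .
  have h: "h \<in> carrier_mat 1 ?r" unfolding h_def using n g by (rule mult_carrier_mat)
  have b': "set [b] \<subseteq> {..<?r}" using b by simp
  have J: "(i, [b]) \<in> Gr_index 1 E" using i b by (simp add: Gr_index_iff charts_at_def)
  have chart: "(x, K) \<in> Gr_chart X 1 E (i, [b])"
    "Gr_matrix 1 E (i, [b]) (x, K) = (inverse (h $$ (0, b)) \<cdot>\<^sub>m 1\<^sub>m 1) * h" if hb: "h $$ (0, b) \<noteq> 0"
  proof -
    let ?T = "inverse (h $$ (0, b)) \<cdot>\<^sub>m 1\<^sub>m 1" and ?T' = "h $$ (0, b) \<cdot>\<^sub>m 1\<^sub>m 1"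
    have T: "?T \<in> carrier_mat 1 1" "?T' \<in> carrier_mat 1 1" "?T' * ?T = 1\<^sub>m 1"
      using hb by (auto intro!: eq_matI simp: scalar_prod_def)
    have "K = kernel_at E 1 x i (?T * h)"
      using K kernel_at_change_frame[OF E j i n] kernel_at_mult_left[OF T h] by (simp add: h_def)
    moreover have "?T * h * column_selection ?r [b] = 1\<^sub>m 1"
      using mult_column_selection[OF mult_carrier_mat[OF T(1) h] b'] h hb b
      by (auto intro!: eq_matI simp: scalar_prod_def)
    ultimately show "(x, K) \<in> Gr_chart X 1 E (i, [b])" "Gr_matrix 1 E (i, [b]) (x, K) = ?T * h"
      using Gr_chartI[OF E J i mult_carrier_mat[OF T(1) h]] by blast+
  qed
  show "(x, K) \<in> Gr_chart X 1 E (i, [b]) \<longleftrightarrow> h $$ (0, b) \<noteq> 0"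
  proof
    assume p: "(x, K) \<in> Gr_chart X 1 E (i, [b])"
    note M = Gr_matrix_chart[OF E J p]
    let ?M = "Gr_matrix 1 E (i, [b]) (x, K)"
    show "h $$ (0, b) \<noteq> 0"
    proof
      assume hb: "h $$ (0, b) = 0"
      obtain v where v: "v \<in> fibre E x" "v i = unit_vec ?r b"
        using fibre_vector_exists[OF E i unit_vec_carrier] .
      have "n *\<^sub>v v j = h *\<^sub>v unit_vec ?r b"
        using fibre_change_frame[OF v(1) j i] v(2) assoc_mult_mat_vec[OF n g] by (simp add: h_def)
      also have "\<dots> = 0\<^sub>v 1" using hb h b by (auto intro!: eq_vecI simp: row_def)
      finally have "v \<in> K" using v(1) K by (simp add: kernel_at_def)
      then have "v \<in> kernel_at E 1 x i ?M" using M(3) by blast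
      then have "?M *\<^sub>v unit_vec ?r b = 0\<^sub>v 1" using v(2) by (simp add: kernel_at_def)
      then have "?M $$ (0, b) = 0"
        using M(2) b by (auto dest!: arg_cong[where f = "\<lambda>v. v $ 0"] simp: row_def)
      moreover have "?M $$ (0, b) = 1"
        using M(4) mult_column_selection[OF M(2) b'] by (auto dest!: arg_cong[where f = "\<lambda>A. A $$ (0, 0)"])
      ultimately show False by simp
    qed
  qed (rule chart)
  show "Gr_matrix 1 E (i, [b]) (x, K) $$ (0, c) = h $$ (0, c) * inverse (h $$ (0, b))"
    if "h $$ (0, b) \<noteq> 0" "c < ?r"
    using chart(2)[OF that(1)] that(2) h by (simp add: scalar_prod_def)
qed

text \<open>
  The functor of points of a projective bundle: a family of
  one-dimensional quotients is a morphism if locally it is the family of kernels of a row of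
  regular functions.  The frame in which the row is given may vary from point to point and need
  not be the frame of the chart under consideration.
\<close>

lemma morphism_to_Proj:
  assumes E: "vector_bundle X E"
    and points: "\<And>q. q \<in> S \<Longrightarrow> \<phi> q \<in> Gr_points X 1 E"
    and base: "\<And>U f. openin (zariski X) U \<Longrightarrow> f \<in> regular X U
      \<Longrightarrow> (\<lambda>q. f (fst (\<phi> q))) \<in> regular (generate S G) {q \<in> S. fst (\<phi> q) \<in> U}"
    and loc: "\<And>p. p \<in> S \<Longrightarrow> \<exists>W j n. p \<in> W \<and> openin (zariski (generate S G)) W \<and> j \<in> idx E \<and>
      (\<forall>q\<in>W. n q \<in> carrier_mat 1 (vrank E) \<and> fst (\<phi> q) \<in> chart E j \<and>
        snd (\<phi> q) = kernel_at E 1 (fst (\<phi> q)) j (n q)) \<and>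
      (\<forall>c<vrank E. (\<lambda>q. n q $$ (0, c)) \<in> regular (generate S G) W)"
  shows "morphism (generate S G) (Proj X E) \<phi>"
  unfolding Gr_def
proof (rule morphism_generate)
  let ?r = "vrank E"
  fix D f
  assume "(D, f) \<in> {(fst -` U, f \<circ> fst) |U f. openin (zariski X) U \<and> f \<in> regular X U} \<union>
    {(Gr_chart X 1 E iJ, \<lambda>p. Gr_matrix 1 E iJ p $$ (a, b)) |iJ a b. iJ \<in> Gr_index 1 E \<and> a < 1 \<and> b < ?r}"
  then show "f \<circ> \<phi> \<in> regular (generate S G) {q \<in> S. \<phi> q \<in> D}"
  proof
    assume "(D, f) \<in> {(fst -` U, f \<circ> fst) |U f. openin (zariski X) U \<and> f \<in> regular X U}"
    then obtain U g where U: "openin (zariski X) U" "g \<in> regular X U" "D = fst -` U" "f = g \<circ> fst"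
      by blast
    then show ?thesis using base[OF U(1,2)] by (simp add: o_def)
  next
    assume "(D, f) \<in> {(Gr_chart X 1 E iJ, \<lambda>p. Gr_matrix 1 E iJ p $$ (a, b)) |iJ a b.
      iJ \<in> Gr_index 1 E \<and> a < 1 \<and> b < ?r}"
    then obtain i J c where iJ: "(i, J) \<in> Gr_index 1 E" and c: "c < ?r" and D: "D = Gr_chart X 1 E (i, J)"
      and f: "f = (\<lambda>p. Gr_matrix 1 E (i, J) p $$ (0, c))" by auto
    then obtain b where J: "J = [b]" and b: "b < ?r" and i: "i \<in> idx E"
      by (auto simp: Gr_index_iff length_Suc_conv)
    show ?thesis
    proof (rule regular_local)
      fix p assume p: "p \<in> {q \<in> S. \<phi> q \<in> D}"
      then have "p \<in> S" by simp
      from loc[OF this] obtain W j n where W: "p \<in> W" "openin (zariski (generate S G)) W" and j: "j \<in> idx E"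
        and n': "\<forall>q\<in>W. n q \<in> carrier_mat 1 ?r \<and> fst (\<phi> q) \<in> chart E j \<and>
          snd (\<phi> q) = kernel_at E 1 (fst (\<phi> q)) j (n q)"
        and nreg: "\<forall>c<?r. (\<lambda>q. n q $$ (0, c)) \<in> regular (generate S G) W"
        by blast
      have n: "n q \<in> carrier_mat 1 ?r" "fst (\<phi> q) \<in> chart E j"
        "snd (\<phi> q) = kernel_at E 1 (fst (\<phi> q)) j (n q)" if "q \<in> W" for q
        using n' that by blast+
      let ?B = "{q \<in> S. fst (\<phi> q) \<in> chart E j \<inter> chart E i}"
      let ?W = "W \<inter> ?B"
      define h where "h q = n q * transition E j i (fst (\<phi> q))" for q
      have greg: "(\<lambda>q. transition E j i (fst (\<phi> q)) $$ (d, e)) \<in> regular (generate S G) ?B"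
        if "d < ?r" "e < ?r" for d e
        using that chart_open[OF E] i j by (intro base openin_Int transition_regular[OF E]) auto
      have W': "openin (zariski (generate S G)) ?W"
        using W(2) regular_openin[OF greg[OF b b]] by (rule openin_Int)
      have frames: "i \<in> charts_at E (fst (\<phi> q))" "j \<in> charts_at E (fst (\<phi> q))" if "q \<in> ?W" for q
        using that i j by (auto simp: charts_at_def)
      have hreg: "(\<lambda>q. h q $$ (0, e)) \<in> regular (generate S G) ?W" if e: "e < ?r" for e
      proof (rule regular_cong)
        show "(\<lambda>q. \<Sum>d\<in>{0..<?r}. n q $$ (0, d) * transition E j i (fst (\<phi> q)) $$ (d, e)) \<in>
            regular (generate S G) ?W"
        proof (intro regular_sum regular_mult)
          fix d assume "d \<in> {0..<?r}"
          then have d: "d < ?r" by simp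
          show "(\<lambda>q. n q $$ (0, d)) \<in> regular (generate S G) ?W"
            using nreg[rule_format, OF d] W' by (rule regular_restrict) simp
          show "(\<lambda>q. transition E j i (fst (\<phi> q)) $$ (d, e)) \<in> regular (generate S G) ?W"
            using greg[OF d e] W' by (rule regular_restrict) simp
        qed (rule W')
        fix q assume q: "q \<in> ?W"
        then show "h q $$ (0, e) = (\<Sum>d\<in>{0..<?r}. n q $$ (0, d) * transition E j i (fst (\<phi> q)) $$ (d, e))"
          using n(1)[of q] transition_carrier[OF E frames(2,1)[OF q]] e
          by (simp add: h_def scalar_prod_def)
      qed
      have chart: "\<phi> q \<in> Gr_chart X 1 E (i, [b]) \<longleftrightarrow> h q $$ (0, b) \<noteq> 0"
        "h q $$ (0, b) \<noteq> 0 \<Longrightarrow>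
          Gr_matrix 1 E (i, [b]) (\<phi> q) $$ (0, c) = h q $$ (0, c) * inverse (h q $$ (0, b))" if "q \<in> ?W" for q
        using projective_chart[OF E frames[OF that] n(1) b n(3)] that c by (simp_all add: h_def)
      let ?V = "{q \<in> ?W. h q $$ (0, b) \<noteq> 0}"
      have "openin (zariski (generate S G)) ?V"
        using regular_inverse[OF hreg[OF b]] by (rule regular_openin)
      then have "(\<lambda>q. h q $$ (0, c)) \<in> regular (generate S G) ?V"
        by (rule regular_restrict[OF hreg[OF c]]) blast
      from regular_mult[OF this regular_inverse[OF hreg[OF b]]]
      have "(\<lambda>q. h q $$ (0, c) * inverse (h q $$ (0, b))) \<in> regular (generate S G) ?V" .
      moreover have "(f \<circ> \<phi>) q = h q $$ (0, c) * inverse (h q $$ (0, b))" if "q \<in> ?V" for q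
        using chart(2)[of q] that by (simp add: f J)
      moreover have "?V \<subseteq> {q \<in> S. \<phi> q \<in> D}"
        using chart(1) by (auto simp: D J)
      moreover have "p \<in> ?V"
      proof -
        have "fst (\<phi> p) \<in> chart E i" using p by (auto simp: D Gr_chart_def charts_at_def)
        then have "p \<in> ?W" using W(1) n(2) p by auto
        then show ?thesis using chart(1)[of p] p by (auto simp: D J)
      qed
      ultimately show "\<exists>V g. p \<in> V \<and> V \<subseteq> {q \<in> S. \<phi> q \<in> D} \<and> g \<in> regular (generate S G) V \<and>
          (\<forall>q\<in>V. (f \<circ> \<phi>) q = g q)"
        by (intro exI[of _ ?V] exI[of _ "\<lambda>q. h q $$ (0, c) * inverse (h q $$ (0, b))"]) blast
    qed
  qed
qed (rule points)

text \<open>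
  The projection \<open>E\<^sub>x \<rightarrow> E\<^sub>x / K\<close> at the point \<open>p = (x, K)\<close>, in the frames of the universal quotient; the
  value \<open>0\<close> in the other frames is the convention of \<^const>\<open>fibre\<close>.
\<close>

definition quotient_class ::
  "'a fspace \<Rightarrow> nat \<Rightarrow> ('a, 'i) vbundle \<Rightarrow> 'a \<times> ('i \<Rightarrow> complex Matrix.vec) set
    \<Rightarrow> ('i \<Rightarrow> complex Matrix.vec) \<Rightarrow> 'i \<times> nat list \<Rightarrow> complex Matrix.vec" where
  "quotient_class X k E p v = (\<lambda>iJ. if iJ \<in> charts_at (universal_quotient X k E) p
     then Gr_matrix k E iJ p *\<^sub>v v (fst iJ) else 0\<^sub>v k)"

text \<open>
  A quotient \<open>(E\<^sub>x / K) / L\<close> of \<open>E\<^sub>x / K\<close> is also a quotient of \<open>E\<^sub>x\<close>, by the preimage of \<open>L\<close>.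
\<close>

definition composite_quotient ::
  "'a fspace \<Rightarrow> nat \<Rightarrow> ('a, 'i) vbundle
    \<Rightarrow> ('a \<times> ('i \<Rightarrow> complex Matrix.vec) set) \<times> ('i \<times> nat list \<Rightarrow> complex Matrix.vec) set
    \<Rightarrow> 'a \<times> ('i \<Rightarrow> complex Matrix.vec) set" where
  "composite_quotient X k E = (\<lambda>(p, L). (fst p, {v \<in> fibre E (fst p). quotient_class X k E p v \<in> L}))"

lemma universal_quotient_charts_at:
  "iJ \<in> charts_at (universal_quotient X k E) p \<longleftrightarrow> iJ \<in> Gr_index k E \<and> p \<in> Gr_chart X k E iJ"
  by (simp add: charts_at_def)

lemma quotient_class_fibre:
  assumes E: "vector_bundle X E" and v: "v \<in> fibre E (fst p)"
  shows "quotient_class X k E p v \<in> fibre (universal_quotient X k E) p"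
proof -
  let ?Q = "universal_quotient X k E" and ?r = "vrank E"
  obtain x K where x: "p = (x, K)" by (cases p)
  have carrier: "quotient_class X k E p v iJ \<in> carrier_vec k" for iJ
  proof (cases iJ)
    case (Pair i J)
    have "Gr_matrix k E iJ p \<in> carrier_mat k ?r" if "iJ \<in> charts_at ?Q p"
      using that Gr_matrix_chart(2)[OF E] Pair x by (auto simp: universal_quotient_charts_at)
    then show ?thesis using fibre_carrier[OF v] by (auto simp: quotient_class_def)
  qed
  have change: "quotient_class X k E p v iJ = transition ?Q iJ jJ' p *\<^sub>v quotient_class X k E p v jJ'"
    if charts: "iJ \<in> charts_at ?Q p" "jJ' \<in> charts_at ?Q p" for iJ jJ'
  proof -
    obtain i J j J' where ij: "iJ = (i, J)" "jJ' = (j, J')" by (cases iJ, cases jJ')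
    have iJ: "(i, J) \<in> Gr_index k E" "(x, K) \<in> Gr_chart X k E (i, J)"
      and jJ': "(j, J') \<in> Gr_index k E" "(x, K) \<in> Gr_chart X k E (j, J')"
      using charts ij x by (simp_all add: universal_quotient_charts_at)
    note G = Gr_matrix_chart[OF E iJ] and G' = Gr_matrix_chart[OF E jJ']
    let ?M = "Gr_matrix k E (i, J) (x, K)" and ?M' = "Gr_matrix k E (j, J') (x, K)"
    let ?g = "transition E i j x" and ?S = "column_selection ?r J'"
    have S: "?S \<in> carrier_mat ?r k" using jJ' by (simp add: Gr_index_iff column_selection_carrier)
    have g: "?g \<in> carrier_mat ?r ?r" using transition_carrier[OF E G(1) G'(1)] .
    have Mg: "?M * ?g \<in> carrier_mat k ?r" using G(2) g by (rule mult_carrier_mat)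
    have vj: "v j \<in> carrier_vec ?r" using fibre_carrier[OF v] .
    have "?M *\<^sub>v v i = (?M * ?g) *\<^sub>v v j"
      using fibre_change_frame[OF v[unfolded x fst_conv] G(1) G'(1)] assoc_mult_mat_vec[OF G(2) g vj] by simp
    also have "?M * ?g = ?M * ?g * ?S * ?M'"
      by (rule factor_through_section[OF E G(1) G'(1) G(2) G'(2) S G'(4), symmetric])
        (use G(3) G'(3) in simp)
    also have "\<dots> *\<^sub>v v j = (?M * ?g * ?S) *\<^sub>v (?M' *\<^sub>v v j)"
      using assoc_mult_mat_vec[OF mult_carrier_mat[OF Mg S] G'(2) vj] .
    also have "?M * ?g * ?S = transition ?Q iJ jJ' p"
      using universal_quotient_transition[OF E iJ(1) jJ'(1) iJ(2) jJ'(2)] ij x by simp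
    finally show ?thesis using charts ij x by (simp add: quotient_class_def)
  qed
  have outside: "quotient_class X k E p v iJ = 0\<^sub>v k" if "iJ \<notin> charts_at ?Q p" for iJ
    using that by (simp add: quotient_class_def)
  show ?thesis
    unfolding fibre_def universal_quotient_simps using carrier outside change by blast
qed

text \<open>The matrix of the composite quotient map is the product of the matrices of the two maps.\<close>

lemma composite_kernel:
  assumes E: "vector_bundle X E" and J: "(i, J) \<in> Gr_index k E" and p: "(x, K) \<in> Gr_chart X k E (i, J)"
    and m: "m \<in> carrier_mat l k"
  shows "composite_quotient X k E ((x, K), kernel_at (universal_quotient X k E) l (x, K) (i, J) m)
    = (x, kernel_at E l x i (m * Gr_matrix k E (i, J) (x, K)))"
proof -
  have "quotient_class X k E (x, K) v \<in> kernel_at (universal_quotient X k E) l (x, K) (i, J) m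
      \<longleftrightarrow> (m * Gr_matrix k E (i, J) (x, K)) *\<^sub>v v i = 0\<^sub>v l" if v: "v \<in> fibre E x" for v
    using quotient_class_fibre[OF E, of v "(x, K)" k] v J p
      assoc_mult_mat_vec[OF m Gr_matrix_chart(2)[OF E J p] fibre_carrier[OF v]]
    by (simp add: kernel_at_def quotient_class_def universal_quotient_charts_at)
  then show ?thesis by (auto simp: composite_quotient_def kernel_at_def)
qed

lemma column_selection_compose:
  assumes "length J = k" "set L \<subseteq> {..<k}" "set J \<subseteq> {..<r}"
  shows "column_selection r J * column_selection k L = column_selection r (map ((!) J) L)"
proof -
  have L: "L ! b < k" if "b < length L" for b using assms(2) nth_mem that by fastforce
  show ?thesis
    unfolding mult_column_selection[OF column_selection_carrier[OF assms(1)] assms(2)]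
    using L assms(1) by (intro eq_matI) (auto simp: column_selection_def)
qed

text \<open>
  The frame of the iterated universal quotient in the chart \<open>((i, J), L)\<close> consists of the classes of
  the basis vectors \<open>e\<^sub>J\<^sub>!\<^sub>a\<close>, \<open>a \<in> L\<close>, of the frame \<open>i\<close> of \<open>E\<close>.  So this chart is mapped into the following
  chart of the Grassmann bundle of \<open>E\<close>.
\<close>

definition composite_index :: "('i \<times> nat list) \<times> nat list \<Rightarrow> 'i \<times> nat list" where
  "composite_index = (\<lambda>((i, J), L). (i, map ((!) J) L))"

lemma composite_index_Gr_index:
  assumes A: "A \<in> Gr_index l (universal_quotient X k E)"
  shows "composite_index A \<in> Gr_index l E"
proof -
  obtain i J L where AJ: "A = ((i, J), L)" using prod.collapse by metis
  then have iJ: "i \<in> idx E" "length J = k" "set J \<subseteq> {..<vrank E}" and L: "length L = l" "set L \<subseteq> {..<k}"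
    using A by (simp_all add: Gr_index_iff)
  have "J ! a \<in> {..<vrank E}" if "a \<in> set L" for a
    using that iJ L by (metis lessThan_iff nth_mem subsetD)
  then show ?thesis using AJ iJ L by (auto simp: composite_index_def Gr_index_iff)
qed

lemma composite_chart:
  fixes X :: "'a fspace" and E :: "('a, 'i) vbundle"
  assumes E: "vector_bundle X E" and k: "1 \<le> k"
    and A: "A \<in> Gr_index l (universal_quotient X k E)" and q: "q \<in> Gr_chart (Gr X k E) l (universal_quotient X k E) A"
  shows "composite_quotient X k E q \<in> Gr_chart X l E (composite_index A)"
    and "Gr_matrix l E (composite_index A) (composite_quotient X k E q)
      = Gr_matrix l (universal_quotient X k E) A q * Gr_matrix k E (fst A) (fst q)"
proof -
  let ?Q = "universal_quotient X k E"
  let ?r = "vrank E"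
  obtain i J L where AJ: "A = ((i, J), L)" using prod.collapse by metis
  obtain x K Z where qx: "q = ((x, K), Z)" using prod.collapse by metis
  have iJ: "(i, J) \<in> Gr_index k E" and L: "length L = l" "set L \<subseteq> {..<k}"
    using A AJ by (auto simp: Gr_index_def)
  note m = Gr_matrix_chart[OF universal_quotient_vector_bundle[OF E k] A[unfolded AJ] q[unfolded AJ qx]]
  let ?m = "Gr_matrix l ?Q ((i, J), L) ((x, K), Z)" and ?M = "Gr_matrix k E (i, J) (x, K)"
  have p: "(x, K) \<in> Gr_chart X k E (i, J)" using m(1) by (simp add: universal_quotient_charts_at)
  note M = Gr_matrix_chart[OF E iJ p]
  have J: "length J = k" "set J \<subseteq> {..<?r}" using iJ by (simp_all add: Gr_index_iff)
  have m': "?m \<in> carrier_mat l k" "?m * column_selection k L = 1\<^sub>m l" using m(2,4) by simp_all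
  have mM: "?m * ?M \<in> carrier_mat l ?r" using m'(1) M(2) by (rule mult_carrier_mat)
  have SJ: "column_selection ?r J \<in> carrier_mat ?r k" and SL: "column_selection k L \<in> carrier_mat k l"
    using J L by (simp_all add: column_selection_carrier)
  have comp: "composite_quotient X k E q = (x, kernel_at E l x i (?m * ?M))"
    using composite_kernel[OF E iJ p m'(1), folded m(3)] qx by simp
  have "?m * ?M * column_selection ?r (map ((!) J) L)
      = ?m * ?M * (column_selection ?r J * column_selection k L)"
    using column_selection_compose[OF J(1) L(2) J(2)] by simp
  also have "\<dots> = ?m * (?M * column_selection ?r J) * column_selection k L"
    using assoc_mult_mat[OF mM SJ SL] assoc_mult_mat[OF m'(1) M(2) SJ] by simp
  also have "\<dots> = 1\<^sub>m l" using M(4) m' by simp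
  finally have one: "?m * ?M * column_selection ?r (map ((!) J) L) = 1\<^sub>m l" .
  have idx: "(i, map ((!) J) L) \<in> Gr_index l E"
    using composite_index_Gr_index[OF A] by (simp add: AJ composite_index_def)
  show "composite_quotient X k E q \<in> Gr_chart X l E (composite_index A)"
    using Gr_chartI(1)[OF E idx M(1) mM refl one] by (simp add: comp AJ composite_index_def)
  show "Gr_matrix l E (composite_index A) (composite_quotient X k E q)
      = Gr_matrix l ?Q A q * Gr_matrix k E (fst A) (fst q)"
    using Gr_chartI(2)[OF E idx M(1) mM refl one] comp by (simp add: AJ qx composite_index_def)
qed

text \<open>
  The frames of the iterated universal quotient are pulled back frames of the universal quotient
  of \<open>E\<close>, so the transitions agree on the nose and not merely up to isomorphism.
\<close>

lemma composite_transition: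
  fixes X :: "'a fspace" and E :: "('a, 'i) vbundle"
  assumes E: "vector_bundle X E" and k: "1 \<le> k"
    and A: "A \<in> Gr_index l (universal_quotient X k E)" and B: "B \<in> Gr_index l (universal_quotient X k E)"
    and q: "q \<in> Gr_chart (Gr X k E) l (universal_quotient X k E) A" "q \<in> Gr_chart (Gr X k E) l (universal_quotient X k E) B"
  shows "transition (universal_quotient (Gr X k E) l (universal_quotient X k E)) A B q
    = transition (universal_quotient X l E) (composite_index A) (composite_index B) (composite_quotient X k E q)"
proof -
  let ?Q = "universal_quotient X k E"
  let ?r = "vrank E"
  obtain i J L where A': "A = ((i, J), L)" using prod.collapse by metis
  obtain j J' L' where B': "B = ((j, J'), L')" using prod.collapse by metis
  obtain x K Z where qx: "q = ((x, K), Z)" using prod.collapse by metis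
  note AB = A' B'
  note QB = universal_quotient_vector_bundle[OF E k]
  have iJ: "(i, J) \<in> Gr_index k E" and jJ': "(j, J') \<in> Gr_index k E" and L': "length L' = l" "set L' \<subseteq> {..<k}"
    using A B AB by (auto simp: Gr_index_def)
  note m = Gr_matrix_chart[OF QB A[unfolded AB] q(1)[unfolded AB qx]]
  note m' = Gr_matrix_chart[OF QB B[unfolded AB] q(2)[unfolded AB qx]]
  let ?m = "Gr_matrix l ?Q ((i, J), L) ((x, K), Z)" and ?M = "Gr_matrix k E (i, J) (x, K)"
  let ?g = "transition E i j x" and ?S = "column_selection ?r J'" and ?S' = "column_selection k L'"
  have p: "(x, K) \<in> Gr_chart X k E (i, J)" "(x, K) \<in> Gr_chart X k E (j, J')"
    using m(1) m'(1) by (simp_all add: universal_quotient_charts_at)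
  note M = Gr_matrix_chart[OF E iJ p(1)] and M' = Gr_matrix_chart[OF E jJ' p(2)]
  have J': "length J' = k" "set J' \<subseteq> {..<?r}" using jJ' by (simp_all add: Gr_index_iff)
  have mc: "?m \<in> carrier_mat l k" using m(2) by simp
  have g: "?g \<in> carrier_mat ?r ?r" using transition_carrier[OF E M(1) M'(1)] .
  have S: "?S \<in> carrier_mat ?r k" "?S' \<in> carrier_mat k l" using J' L' by (simp_all add: column_selection_carrier)
  have Mg: "?M * ?g \<in> carrier_mat k ?r" using M(2) g by (rule mult_carrier_mat)
  have "transition (universal_quotient (Gr X k E) l ?Q) A B q = ?m * (?M * ?g * ?S) * ?S'"
    using universal_quotient_transition[OF QB A[unfolded AB] B[unfolded AB]] q AB qx
      universal_quotient_transition[OF E iJ jJ' p] by simp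
  also have "\<dots> = ?m * (?M * ?g) * (?S * ?S')"
    using assoc_mult_mat[OF mc Mg S(1)] assoc_mult_mat[OF mult_carrier_mat[OF mc Mg] S] by simp
  also have "\<dots> = ?m * ?M * ?g * column_selection ?r (map ((!) J') L')"
    using assoc_mult_mat[OF mc M(2) g] column_selection_compose[OF J'(1) L'(2) J'(2)] by simp
  also have "\<dots> = transition (universal_quotient X l E) (composite_index A) (composite_index B)
      (composite_quotient X k E q)"
    using universal_quotient_transition[OF E, of i "map ((!) J) L" l j "map ((!) J') L'" "composite_quotient X k E q"]
      composite_index_Gr_index[OF A] composite_index_Gr_index[OF B] composite_chart[OF E k A q(1)] composite_chart[OF E k B q(2)]
    by (simp add: AB qx composite_index_def composite_quotient_def)
  finally show ?thesis .
qed

text \<open>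
  Over a chart of \<open>\<P>(Q)\<close> the composite quotient is the kernel of the row \<open>m M\<close>, where \<open>m\<close> and \<open>M\<close> are the
  normal matrices of the chart of \<open>\<P>(Q)\<close> and of the underlying chart of the Grassmann bundle; its entries are
  polynomials in the coordinates.
\<close>

lemma composite_quotient_morphism:
  fixes X :: "'a fspace" and E :: "('a, 'i) vbundle"
  assumes E: "vector_bundle X E" and k: "1 \<le> k"
  shows "morphism (Proj (Gr X k E) (universal_quotient X k E)) (Proj X E) (composite_quotient X k E)"
proof -
  let ?Y = "Gr X k E" and ?Q = "universal_quotient X k E" and ?\<phi> = "composite_quotient X k E"
  let ?P = "Proj ?Y ?Q" and ?r = "vrank E"
  note QB = universal_quotient_vector_bundle[OF E k]
  have fst: "fst (?\<phi> q) = fst (fst q)" for q by (simp add: composite_quotient_def case_prod_beta)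
  have points: "?\<phi> q \<in> Gr_points X 1 E" if q: "q \<in> Gr_points ?Y 1 ?Q" for q
  proof -
    obtain A where "A \<in> Gr_index 1 ?Q" "q \<in> Gr_chart ?Y 1 ?Q A"
      using q Gr_charts_cover[OF QB, of 1] by blast
    from composite_chart(1)[OF E k this] show ?thesis using Gr_chart_points by blast
  qed
  have base: "(\<lambda>q. f (fst (?\<phi> q))) \<in> regular ?P {q \<in> Gr_points ?Y 1 ?Q. fst (?\<phi> q) \<in> U}"
    if U: "openin (zariski X) U" "f \<in> regular X U" for U f
  proof -
    let ?V = "{p \<in> Gr_points X k E. fst p \<in> U}"
    have f: "(\<lambda>p. f (fst p)) \<in> regular ?Y ?V" using Gr_regular_base[OF U] .
    then have "openin (zariski ?Y) ?V" unfolding Gr_def by (rule regular_openin)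
    from Gr_regular_base[OF this f]
    have "(\<lambda>q. f (fst (fst q))) \<in> regular ?P {q \<in> Gr_points ?Y 1 ?Q. fst q \<in> ?V}" .
    moreover have "{q \<in> Gr_points ?Y 1 ?Q. fst q \<in> ?V} = {q \<in> Gr_points ?Y 1 ?Q. fst (?\<phi> q) \<in> U}"
      using Gr_points_pts[of _ ?Y 1 ?Q] fst by auto
    ultimately show ?thesis by (simp add: fst)
  qed
  have loc: "\<exists>W j n. p \<in> W \<and> openin (zariski ?P) W \<and> j \<in> idx E \<and>
      (\<forall>q\<in>W. n q \<in> carrier_mat 1 ?r \<and> fst (?\<phi> q) \<in> chart E j \<and>
        snd (?\<phi> q) = kernel_at E 1 (fst (?\<phi> q)) j (n q)) \<and>
      (\<forall>c<?r. (\<lambda>q. n q $$ (0, c)) \<in> regular ?P W)"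
    if p: "p \<in> Gr_points ?Y 1 ?Q" for p
  proof -
    obtain A where A: "A \<in> Gr_index 1 ?Q" and pA: "p \<in> Gr_chart ?Y 1 ?Q A"
      using p Gr_charts_cover[OF QB, of 1] by blast
    let ?W = "Gr_chart ?Y 1 ?Q A" and ?i = "fst (composite_index A)"
    define n where "n q = Gr_matrix 1 E (composite_index A) (?\<phi> q)" for q
    have W: "openin (zariski ?P) ?W" using openin_Gr_chart[OF A] by simp
    have idx: "composite_index A \<in> Gr_index 1 E" using composite_index_Gr_index[OF A] .
    have kernel: "n q \<in> carrier_mat 1 ?r" "fst (?\<phi> q) \<in> chart E ?i"
        "snd (?\<phi> q) = kernel_at E 1 (fst (?\<phi> q)) ?i (n q)" if q: "q \<in> ?W" for q
      using Gr_matrix_chart[OF E, of ?i "snd (composite_index A)" 1 "fst (?\<phi> q)" "snd (?\<phi> q)"]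
        idx composite_chart(1)[OF E k A q]
      unfolding n_def prod.collapse charts_at_def by blast+
    have A1: "fst A \<in> Gr_index k E" using A by (cases A) (simp add: Gr_index_iff)
    have WV: "?W \<subseteq> {q \<in> Gr_points ?Y 1 ?Q. fst q \<in> Gr_chart X k E (fst A)}"
      by (auto simp: Gr_chart_def[of ?Y] charts_at_def)
    have "(\<lambda>q. n q $$ (0, c)) \<in> regular ?P ?W" if c: "c < ?r" for c
    proof -
      have "(\<lambda>q. \<Sum>d\<in>{0..<k}. Gr_matrix 1 ?Q A q $$ (0, d) * Gr_matrix k E (fst A) (fst q) $$ (d, c))
          \<in> regular ?P ?W"
        unfolding Gr_def[of ?Y]
      proof (intro regular_sum regular_mult, fold Gr_def[of ?Y])
        fix d assume "d \<in> {0..<k}"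
        then have d: "d < k" by simp
        show "(\<lambda>q. Gr_matrix 1 ?Q A q $$ (0, d)) \<in> regular ?P ?W"
          using Gr_regular_matrix[OF A, of 0 d] d by simp
        have "(\<lambda>q. Gr_matrix k E (fst A) (fst q) $$ (d, c)) \<in>
            regular ?P {q \<in> Gr_points ?Y 1 ?Q. fst q \<in> Gr_chart X k E (fst A)}"
          using openin_Gr_chart[OF A1 k] Gr_regular_matrix[OF A1 d c] by (rule Gr_regular_base)
        then show "(\<lambda>q. Gr_matrix k E (fst A) (fst q) $$ (d, c)) \<in> regular ?P ?W"
          using W WV unfolding Gr_def[of ?Y] by (rule regular_restrict)
      qed (rule W)
      moreover have "n q $$ (0, c)
          = (\<Sum>d\<in>{0..<k}. Gr_matrix 1 ?Q A q $$ (0, d) * Gr_matrix k E (fst A) (fst q) $$ (d, c))"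
        if q: "q \<in> ?W" for q
      proof -
        have "Gr_matrix 1 ?Q A q \<in> carrier_mat 1 k"
          using Gr_matrix_chart(2)[OF QB, of "fst A" "snd A" 1 "fst q" "snd q"] A q by simp
        moreover have "Gr_matrix k E (fst A) (fst q) \<in> carrier_mat k ?r"
          using Gr_matrix_chart(2)[OF E, of "fst (fst A)" "snd (fst A)" k "fst (fst q)" "snd (fst q)"]
            A1 q WV by auto
        ultimately show ?thesis
          using composite_chart(2)[OF E k A q] c by (simp add: n_def scalar_prod_def)
      qed
      ultimately show ?thesis unfolding Gr_def[of ?Y] by (rule regular_cong)
    qed
    moreover have "?i \<in> idx E" using idx by (cases "composite_index A") (simp add: Gr_index_iff)
    ultimately show ?thesis using pA W kernel
      by (intro exI[of _ ?W] exI[of _ ?i] exI[of _ n] conjI ballI allI impI) simp_all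
  qed
  obtain G where G: "?P = generate (Gr_points ?Y 1 ?Q) G" using Gr_def by blast
  have "morphism (generate (Gr_points ?Y 1 ?Q) G) (Proj X E) ?\<phi>"
  proof (rule morphism_to_Proj[OF E])
    show "?\<phi> q \<in> Gr_points X 1 E" if "q \<in> Gr_points ?Y 1 ?Q" for q
      using that by (rule points)
  next
    fix U f assume "openin (zariski X) U" "f \<in> regular X U"
    then show "(\<lambda>q. f (fst (?\<phi> q))) \<in>
        regular (generate (Gr_points ?Y 1 ?Q) G) {q \<in> Gr_points ?Y 1 ?Q. fst (?\<phi> q) \<in> U}"
      by (rule base[unfolded G])
  next
    fix p assume "p \<in> Gr_points ?Y 1 ?Q"
    then show "\<exists>W j n. p \<in> W \<and> openin (zariski (generate (Gr_points ?Y 1 ?Q) G)) W \<and> j \<in> idx E \<and>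
        (\<forall>q\<in>W. n q \<in> carrier_mat 1 ?r \<and> fst (?\<phi> q) \<in> chart E j \<and>
          snd (?\<phi> q) = kernel_at E 1 (fst (?\<phi> q)) j (n q)) \<and>
        (\<forall>c<?r. (\<lambda>q. n q $$ (0, c)) \<in> regular (generate (Gr_points ?Y 1 ?Q) G) W)"
      by (rule loc[unfolded G])
  qed
  then show ?thesis by (simp only: G)
qed

section \<open>Nefness of the universal quotient\<close>

text \<open>
  A curve \<open>\<nu> : C \<rightarrow> \<P>(Q)\<close> composed with \<open>\<P>(Q) \<rightarrow> \<P>(E)\<close> is a curve in \<open>\<P>(E)\<close>, and \<open>\<O>(1)\<close> has the same degree on
  both, because the pull-back of \<open>\<O>(1)\<close> from \<open>\<P>(Q)\<close> refines the cover of the one from \<open>\<P>(E)\<close>.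
\<close>

lemma nef_universal_quotient:
  assumes E: "vector_bundle X E" and nef: "nef X E" and k: "1 \<le> k"
  shows "nef (Gr X k E) (universal_quotient X k E)"
  unfolding nef_def nef_line_bundle_def
proof (intro allI impI, elim conjE)
  let ?Y = "Gr X k E" and ?Q = "universal_quotient X k E" and ?\<phi> = "composite_quotient X k E"
  fix C :: "complex Matrix.vec set fspace" and \<nu>
  assume C: "smooth_projective_variety C 1" and \<nu>: "morphism C (Proj ?Y ?Q) \<nu>"
  let ?M = "pullback C \<nu> (O1 ?Y ?Q)" and ?N = "pullback C (?\<phi> \<circ> \<nu>) (O1 X E)"
  have \<phi>\<nu>: "morphism C (Proj X E) (?\<phi> \<circ> \<nu>)"
    using \<nu> composite_quotient_morphism[OF E k] by (rule morphism_compose)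
  have "c1_line C ?M = c1_line C ?N"
  proof (rule c1_line_refinement[where \<theta> = composite_index])
    show "vector_bundle C ?M"
      using universal_quotient_vector_bundle[OF universal_quotient_vector_bundle[OF E k] le_refl] \<nu>
      by (rule pullback_vector_bundle)
    show "vector_bundle C ?N"
      using universal_quotient_vector_bundle[OF E le_refl] \<phi>\<nu> by (rule pullback_vector_bundle)
    show "composite_index A \<in> idx ?N" if "A \<in> idx ?M" for A
      using that composite_index_Gr_index by simp
    show "chart ?M A \<subseteq> chart ?N (composite_index A)" if "A \<in> idx ?M" for A
    proof
      show "x \<in> chart ?N (composite_index A)" if "x \<in> chart ?M A" for x
        using that \<open>A \<in> idx ?M\<close> composite_chart(1)[OF E k, of A 1 "\<nu> x"] by simp
    qed
    show "transition ?M A B x = transition ?N (composite_index A) (composite_index B) x"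
      if "A \<in> charts_at ?M x" "B \<in> charts_at ?M x" for A B x
      using that composite_transition[OF E k, of A 1 B "\<nu> x"] by (simp add: charts_at_def)
  qed simp
  then have "curve_degree C ?M = curve_degree C ?N" by (simp add: curve_degree_def)
  moreover have "curve_degree C ?N \<ge> 0"
    using nef C \<phi>\<nu> unfolding nef_def nef_line_bundle_def by blast
  ultimately show "curve_degree C ?M \<ge> 0" by simp
qed

theorem corollary1p6:
  fixes X :: "'a fspace" and E :: "('a, 'i) vbundle" and H :: "('a, 'j) vbundle"
    and n r :: nat
  assumes "smooth_projective_variety X n"
    and "vector_bundle X E" and "vrank E = r"
    and "ample X H" and "semistable X n H E"
    and "nef X E"
    and "chern_class X (End_bundle E) 2 = zero_cohomology_class 4 (analytic X)"
  shows "\<forall>k. 1 \<le> k \<and> k \<le> r \<longrightarrow> nef (Gr X k E) (universal_quotient X k E)"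
  using nef_universal_quotient[OF \<open>vector_bundle X E\<close> \<open>nef X E\<close>] by blast

end
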